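(* The following assertions hold: (i) $\mathcal{R}_{\mathrm{q}}\cap\mathcal{R}$ is a starlike region with nonempty interior; (ii) $\mathcal{R}\setminus\mathcal{R}_{\mathrm{q}}$ and $\mathcal{R}_{\mathrm{q}}\setminus\mathcal{R}$ are regions with nonempty interiors.
   Context: Weighted shift: for a bounded sequence $\alpha=\{\alpha_n\}_{n\ge0}$ of positive reals, $W_\alpha$ is the bounded operator on $\ell^2(\mathbb{Z}_{\ge 0})$ (complex scalars) with $W_\alpha e_n=\alpha_n e_{n+1}$. An operator $T$ is hyponormal if $T^*T\ge TT^*$; it is semi-cubically hyponormal if $T+sT^3$ is hyponormal for every complex number $s$; it is quadratically hyponormal if $p(T)$ is hyponormal for every complex polynomial $p$ of degree at most $2$ (equivalently, $T+sT^2$ is hyponormal for every complex $s$). Stampfli completion: for $0<\alpha_0<\alpha_1<\alpha_2$, $(\alpha_0,\alpha_1,\alpha_2)^\wedge$ denotes the bounded sequence $\{\widehat\alpha_n\}_{n\ge0}$ with $\widehat\alpha_i=\alpha_i$ for $0\le i\le2$ and $\widehat\alpha_n=\left(\Psi_1+\Psi_0/\widehat\alpha_{n-1}^2\right)^{1/2}$ for $n\ge3$, where $\Psi_0=-\frac{\alpha_0^2\alpha_1^2(\alpha_2^2-\alpha_1^2)}{\alpha_1^2-\alpha_0^2}$ and $\Psi_1=\frac{\alpha_1^2(\alpha_2^2-\alpha_0^2)}{\alpha_1^2-\alpha_0^2}$. For $1<x<y$ let $\alpha(x,y):1,(1,\sqrt{x},\sqrt{y})^\wedge$ be the weight sequence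 whose first weight is $1$, followed by the terms of $(1,\sqrt x,\sqrt y)^\wedge$. Write $x=1+h$, $y=1+h+k$ with $h,k>0$, and set $$\mathcal{R}=\{(h,k): h>0,\ k>0,\ W_{\alpha(1+h,\,1+h+k)}\text{ is semi-cubically hyponormal}\},$$ $$\mathcal{R}_{\mathrm{q}}=\{(h,k): h>0,\ k>0,\ W_{\alpha(1+h,\,1+h+k)}\text{ is quadratically hyponormal}\}.$$ "Region" means a subset of $\mathbb{R}^2$. A region $\mathcal{V}$ in the open first quadrant is starlike (with respect to the origin) if $(h,k)\in\mathcal{V}$ and $0<s\le1$ imply $(sh,sk)\in\mathcal{V}$. *)

theory Defs
  imports "HOL-Analysis.Analysis" "HOL-Computational_Algebra.Polynomial"
begin

text \<open>
  The libraries have no complex Hilbert space \<open>\<ell>\<^sup>2\<close>, so it is given by its carrier inside the type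
  of all complex sequences. Operators are functions on that type of which only the
  restriction to the carrier is relevant.
\<close>

definition ell2 :: "(nat \<Rightarrow> complex) set" where
  "ell2 = {x. summable (\<lambda>n. (cmod (x n))\<^sup>2)}"

definition ell2_inner :: "(nat \<Rightarrow> complex) \<Rightarrow> (nat \<Rightarrow> complex) \<Rightarrow> complex" where
  "ell2_inner x y = (\<Sum>n. x n * cnj (y n))"

definition ell2_norm :: "(nat \<Rightarrow> complex) \<Rightarrow> real" where
  "ell2_norm x = sqrt (\<Sum>n. (cmod (x n))\<^sup>2)"

type_synonym ell2_op = "(nat \<Rightarrow> complex) \<Rightarrow> (nat \<Rightarrow> complex)"

definition bounded_ell2_op :: "ell2_op \<Rightarrow> bool" where
  "bounded_ell2_op T \<longleftrightarrow>
     (\<forall>x\<in>ell2. T x \<in> ell2) \<and>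
     (\<forall>x\<in>ell2. \<forall>y\<in>ell2. \<forall>a b. T (\<lambda>n. a * x n + b * y n) = (\<lambda>n. a * T x n + b * T y n)) \<and>
     (\<exists>K. \<forall>x\<in>ell2. ell2_norm (T x) \<le> K * ell2_norm x)"

text \<open>For a bounded operator, the conditions on \<open>S\<close> determine \<open>S\<close> on \<^const>\<open>ell2\<close>.\<close>

definition ell2_adj :: "ell2_op \<Rightarrow> ell2_op" where
  "ell2_adj T = (SOME S. (\<forall>y\<in>ell2. S y \<in> ell2) \<and>
     (\<forall>x\<in>ell2. \<forall>y\<in>ell2. ell2_inner (T x) y = ell2_inner x (S y)))"

definition ell2_op_ge :: "ell2_op \<Rightarrow> ell2_op \<Rightarrow> bool" where
  "ell2_op_ge A B \<longleftrightarrow> (\<forall>x\<in>ell2. ell2_inner (\<lambda>n. A x n - B x n) x \<in> \<real>\<^sub>\<ge>\<^sub>0)"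

definition hyponormal :: "ell2_op \<Rightarrow> bool" where
  "hyponormal T \<longleftrightarrow> bounded_ell2_op T \<and> ell2_op_ge (ell2_adj T \<circ> T) (T \<circ> ell2_adj T)"

definition poly_op :: "complex poly \<Rightarrow> ell2_op \<Rightarrow> ell2_op" where
  "poly_op p T = (\<lambda>x n. \<Sum>i\<le>degree p. coeff p i * (T ^^ i) x n)"

definition semi_cubically_hyponormal :: "ell2_op \<Rightarrow> bool" where
  "semi_cubically_hyponormal T \<longleftrightarrow>
     (\<forall>s :: complex. hyponormal (\<lambda>x n. T x n + s * (T ^^ 3) x n))"

definition quadratically_hyponormal :: "ell2_op \<Rightarrow> bool" where
  "quadratically_hyponormal T \<longleftrightarrow>
     (\<forall>p :: complex poly. degree p \<le> 2 \<longrightarrow> hyponormal (poly_op p T))"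

definition weighted_shift :: "(nat \<Rightarrow> real) \<Rightarrow> ell2_op" where
  "weighted_shift \<alpha> x = (\<lambda>n. case n of 0 \<Rightarrow> 0 | Suc m \<Rightarrow> of_real (\<alpha> m) * x m)"

definition Psi0 :: "real \<Rightarrow> real \<Rightarrow> real \<Rightarrow> real" where
  "Psi0 a0 a1 a2 = - (a0\<^sup>2 * a1\<^sup>2 * (a2\<^sup>2 - a1\<^sup>2)) / (a1\<^sup>2 - a0\<^sup>2)"

definition Psi1 :: "real \<Rightarrow> real \<Rightarrow> real \<Rightarrow> real" where
  "Psi1 a0 a1 a2 = a1\<^sup>2 * (a2\<^sup>2 - a0\<^sup>2) / (a1\<^sup>2 - a0\<^sup>2)"

fun stampfli_completion :: "real \<Rightarrow> real \<Rightarrow> real \<Rightarrow> nat \<Rightarrow> real" where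
  "stampfli_completion a0 a1 a2 0 = a0"
| "stampfli_completion a0 a1 a2 (Suc 0) = a1"
| "stampfli_completion a0 a1 a2 (Suc (Suc 0)) = a2"
| "stampfli_completion a0 a1 a2 (Suc (Suc (Suc n))) =
     sqrt (Psi1 a0 a1 a2 + Psi0 a0 a1 a2 / (stampfli_completion a0 a1 a2 (Suc (Suc n)))\<^sup>2)"

definition weights :: "real \<Rightarrow> real \<Rightarrow> nat \<Rightarrow> real" where
  "weights x y n = (case n of 0 \<Rightarrow> 1 | Suc m \<Rightarrow> stampfli_completion 1 (sqrt x) (sqrt y) m)"

definition region_sc :: "(real \<times> real) set" where
  "region_sc = {(h, k). h > 0 \<and> k > 0 \<and>
     semi_cubically_hyponormal (weighted_shift (weights (1 + h) (1 + h + k)))}"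

definition region_q :: "(real \<times> real) set" where
  "region_q = {(h, k). h > 0 \<and> k > 0 \<and>
     quadratically_hyponormal (weighted_shift (weights (1 + h) (1 + h + k)))}"

definition starlike_region :: "(real \<times> real) set \<Rightarrow> bool" where
  "starlike_region V \<longleftrightarrow>
     V \<subseteq> {(h, k). h > 0 \<and> k > 0} \<and>
     (\<forall>h k s. (h, k) \<in> V \<and> 0 < s \<and> s \<le> 1 \<longrightarrow> (s * h, s * k) \<in> V)"

end

theory Submission imports Defs begin

text \<open>
  Write \<open>c = k / h\<close> and let \<open>\<beta>\<^sub>n\<close> be the squared weights. They satisfy
  \<open>\<beta>\<^sub>n\<^sub>+\<^sub>1 = (1 + h) * (1 + c * (1 - 1 / \<beta>\<^sub>n))\<close> from \<open>\<beta>\<^sub>1 = 1\<close> on, and scaling \<open>(h, k)\<close> changes \<open>h\<close> while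
  \<open>c\<close> stays fixed.

  For a weighted shift \<open>W\<close>, the commutator form of \<open>b W + c' W\<^bsup>r+1\<^esup>\<close> couples only coordinates at
  distance \<open>r\<close>, and a constant term in the polynomial does not change it. The phases of \<open>b\<close>, \<open>c'\<close> and of the
  coordinates can be chosen freely, so hyponormality for all coefficients means that real forms with a
  single parameter \<open>t = \<bar>c' / b\<bar>\<^sup>2\<close> are nonnegative on finitely supported nonnegative vectors
  (\<open>quadratically_hyponormal_iff_sections\<close> and \<open>semi_cubically_hyponormal_iff_sections\<close>).

  The recursion for \<open>\<beta>\<close> implies that from index \<open>2\<close> on the squared off-diagonal entry of the form is
  \<open>t * u\<^sub>n * v\<^sub>n\<^sub>+\<^sub>r\<close>, where \<open>u\<^sub>n + t * v\<^sub>n\<close> is the diagonal entry (\<open>cross_gap_compl_weight_1\<close>, \<open>cross_gap_compl_weight_2\<close>). Such a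
  chain is a sum of squares, and its Schur complement at the first index \<open>s\<close> is \<open>t * v\<^sub>s + u\<^sub>s / S\<close> with
  \<open>S = \<Sum>m. \<Prod>i<m. t * \<rho>\<^sub>i\<close>, where the \<open>\<rho>\<^sub>i\<close> are the later quotients \<open>v / u\<close> (\<open>chain_form_ge\<close> and
  \<open>chain_form_attained\<close>). These quotients are multiples of \<open>\<beta>\<^sub>n\<close> for \<open>r = 1\<close> and of \<open>\<beta>\<^sub>n * \<beta>\<^sub>n\<^sub>+\<^sub>1\<close> for
  \<open>r = 2\<close>. Eliminating the one or two remaining variables at the start turns each kind of
  hyponormality into one scalar inequality for all \<open>t > 0\<close> and all partial sums
  (\<open>quadratically_hyponormal_compl_weight_iff\<close> and \<open>semi_cubically_hyponormal_compl_weight_iff\<close>). For \<open>r = 2\<close> only the odd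
  coordinates give a condition.

  After a rescaling of \<open>t\<close>, every term of both inequalities is monotone in \<open>h\<close> for fixed \<open>c\<close>, in the
  direction that makes them easier to satisfy as \<open>h\<close> decreases. Hence both regions are starlike, and so
  is their intersection. For each \<open>c\<close> there are therefore thresholds for \<open>h\<close>. They can be located by one value
  of \<open>t\<close>: the \<open>\<beta>\<^sub>n\<close> increase to a limit, so \<open>S\<close> is dominated by a geometric series up to the point where
  it diverges. The cubic threshold is larger than the quadratic one near \<open>c = 1 / 4\<close> and smaller
  near \<open>c = 3\<close>, which yields the open sets in the two differences.
\<close>

section \<open>Square-summable sequences and adjoints\<close>

lemma ell2_add:
  assumes "x \<in> ell2" "y \<in> ell2"
  shows "(\<lambda>n. x n + y n) \<in> ell2"
proof -
  have "summable (\<lambda>n. 2 * (cmod (x n))\<^sup>2 + 2 * (cmod (y n))\<^sup>2)"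
    using assms by (intro summable_add summable_mult) (auto simp: ell2_def)
  moreover have "(cmod (x n + y n))\<^sup>2 \<le> 2 * (cmod (x n))\<^sup>2 + 2 * (cmod (y n))\<^sup>2" for n
  proof -
    have "(cmod (x n + y n))\<^sup>2 \<le> (cmod (x n) + cmod (y n))\<^sup>2"
      by (simp add: norm_triangle_ineq power_mono)
    also have "\<dots> \<le> 2 * (cmod (x n))\<^sup>2 + 2 * (cmod (y n))\<^sup>2"
      using sum_squares_bound[of "cmod (x n)" "cmod (y n)"] by (simp add: power2_sum)
    finally show ?thesis .
  qed
  ultimately show ?thesis
    unfolding ell2_def by (auto intro: summable_comparison_test')
qed

lemma ell2_scale: "x \<in> ell2 \<Longrightarrow> (\<lambda>n. a * x n) \<in> ell2"
  by (simp add: ell2_def norm_mult power_mult_distrib summable_mult)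

lemma ell2_inner_summable:
  assumes "x \<in> ell2" "y \<in> ell2"
  shows "summable (\<lambda>n. x n * cnj (y n))"
proof (rule summable_comparison_test')
  show "summable (\<lambda>n. (cmod (x n))\<^sup>2 + (cmod (y n))\<^sup>2)"
    using assms by (intro summable_add) (auto simp: ell2_def)
  show "norm (x n * cnj (y n)) \<le> (cmod (x n))\<^sup>2 + (cmod (y n))\<^sup>2" if "n \<ge> 0" for n
    using sum_squares_bound[of "cmod (x n)" "cmod (y n)"]
      mult_nonneg_nonneg[OF norm_ge_zero[of "x n"] norm_ge_zero[of "y n"]]
    unfolding norm_mult complex_mod_cnj by linarith
qed

lemma ell2_inner_add_left:
  "x \<in> ell2 \<Longrightarrow> y \<in> ell2 \<Longrightarrow> z \<in> ell2 \<Longrightarrow>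
    ell2_inner (\<lambda>n. x n + y n) z = ell2_inner x z + ell2_inner y z"
  by (simp add: ell2_inner_def distrib_right suminf_add ell2_inner_summable)

lemma ell2_inner_add_right:
  "x \<in> ell2 \<Longrightarrow> y \<in> ell2 \<Longrightarrow> z \<in> ell2 \<Longrightarrow>
    ell2_inner z (\<lambda>n. x n + y n) = ell2_inner z x + ell2_inner z y"
  by (simp add: ell2_inner_def distrib_left suminf_add ell2_inner_summable)

lemma ell2_inner_scale_left:
  "x \<in> ell2 \<Longrightarrow> z \<in> ell2 \<Longrightarrow> ell2_inner (\<lambda>n. a * x n) z = a * ell2_inner x z"
  by (simp add: ell2_inner_def mult.assoc suminf_mult ell2_inner_summable)

lemma ell2_inner_scale_right:
  "x \<in> ell2 \<Longrightarrow> z \<in> ell2 \<Longrightarrow> ell2_inner z (\<lambda>n. a * x n) = cnj a * ell2_inner z x"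
  by (simp add: ell2_inner_def mult.left_commute suminf_mult ell2_inner_summable)

lemma ell2_inner_commute: "ell2_inner y x = cnj (ell2_inner x y)" if "x \<in> ell2" "y \<in> ell2"
proof -
  have "(\<lambda>n. x n * cnj (y n)) sums ell2_inner x y"
    unfolding ell2_inner_def using ell2_inner_summable[OF that] by (rule summable_sums)
  then have "(\<lambda>n. cnj (x n * cnj (y n))) sums cnj (ell2_inner x y)"
    by (simp only: sums_cnj)
  then show ?thesis
    by (simp add: ell2_inner_def sums_iff mult.commute)
qed

lemma ell2_inner_self: "ell2_inner x x = of_real (\<Sum>n. (cmod (x n))\<^sup>2)" if "x \<in> ell2"
proof -
  have "(\<lambda>n. (cmod (x n))\<^sup>2) sums (\<Sum>n. (cmod (x n))\<^sup>2)"
    using that by (simp add: ell2_def summable_sums)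
  then have "(\<lambda>n. of_real ((cmod (x n))\<^sup>2)) sums (of_real (\<Sum>n. (cmod (x n))\<^sup>2) :: complex)"
    by (rule sums_of_real)
  then show ?thesis
    unfolding ell2_inner_def by (simp add: sums_iff complex_norm_square[symmetric] del: of_real_power)
qed

lemma bounded_ell2_opI:
  assumes maps: "\<And>x. x \<in> ell2 \<Longrightarrow> T x \<in> ell2"
    and lin: "\<And>x y a b. T (\<lambda>n. a * x n + b * y n) = (\<lambda>n. a * T x n + b * T y n)"
    and bd: "\<And>x. x \<in> ell2 \<Longrightarrow> (\<Sum>n. (cmod (T x n))\<^sup>2) \<le> K * (\<Sum>n. (cmod (x n))\<^sup>2)"
  shows "bounded_ell2_op T"
proof -
  have "ell2_norm (T x) \<le> sqrt K * ell2_norm x" if "x \<in> ell2" for x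
    using real_sqrt_le_mono[OF bd[OF that]] by (simp add: ell2_norm_def real_sqrt_mult)
  then show ?thesis
    unfolding bounded_ell2_op_def using maps lin by blast
qed

text \<open>Testing against coordinate vectors shows that every adjoint agrees on \<^const>\<open>ell2\<close> with the one
  that \<^const>\<open>ell2_adj\<close> selects, so an explicitly written adjoint \<open>S\<close> may be used. The commutator
  form at \<open>x\<close> is then \<open>\<parallel>T x\<parallel>\<^sup>2 - \<parallel>S x\<parallel>\<^sup>2\<close>.\<close>

lemma hyponormal_iff_norms:
  assumes bd: "bounded_ell2_op T"
    and S: "\<And>y. y \<in> ell2 \<Longrightarrow> S y \<in> ell2"
    and adj: "\<And>x y. x \<in> ell2 \<Longrightarrow> y \<in> ell2 \<Longrightarrow> ell2_inner (T x) y = ell2_inner x (S y)"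
  shows "hyponormal T \<longleftrightarrow>
    (\<forall>x\<in>ell2. 0 \<le> Re (ell2_inner (T x) (T x)) - Re (ell2_inner (S x) (S x)))"
proof -
  let ?P = "\<lambda>S. (\<forall>y\<in>ell2. S y \<in> ell2) \<and>
     (\<forall>x\<in>ell2. \<forall>y\<in>ell2. ell2_inner (T x) y = ell2_inner x (S y))"
  have T: "T x \<in> ell2" if "x \<in> ell2" for x
    using bd that by (auto simp: bounded_ell2_op_def)
  have "?P S" using S adj by blast
  then have P: "?P (ell2_adj T)"
    unfolding ell2_adj_def by (rule someI[of ?P])
  have eq: "ell2_adj T y = S y" if y: "y \<in> ell2" for y
  proof
    fix n
    define e :: "nat \<Rightarrow> complex" where "e = (\<lambda>k. if k = n then 1 else 0)"
    have "summable (\<lambda>k. (cmod (e k))\<^sup>2)"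
      by (rule summable_finite[of "{n}"]) (auto simp: e_def)
    then have e: "e \<in> ell2" by (simp add: ell2_def)
    have val: "ell2_inner e z = cnj (z n)" for z
      unfolding ell2_inner_def by (subst suminf_finite[of "{n}"]) (auto simp: e_def)
    have "ell2_inner e (ell2_adj T y) = ell2_inner e (S y)"
      using P adj[OF e y] e y by metis
    then show "ell2_adj T y n = S y n" by (simp add: val)
  qed
  have "ell2_inner (\<lambda>n. (ell2_adj T \<circ> T) x n - (T \<circ> ell2_adj T) x n) x
      = of_real (Re (ell2_inner (T x) (T x)) - Re (ell2_inner (S x) (S x)))" if x: "x \<in> ell2" for x
  proof -
    have m: "(\<lambda>n. (-1) * T (S x) n) \<in> ell2" using x S T by (intro ell2_scale) auto
    have "ell2_inner (\<lambda>n. (ell2_adj T \<circ> T) x n - (T \<circ> ell2_adj T) x n) x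
        = ell2_inner (\<lambda>n. S (T x) n + (-1) * T (S x) n) x"
      using x S T eq by simp
    also have "\<dots> = ell2_inner (S (T x)) x - ell2_inner (T (S x)) x"
      using x S T m by (simp only: ell2_inner_add_left ell2_inner_scale_left) simp
    also have "ell2_inner (S (T x)) x = ell2_inner (T x) (T x)"
      using x S T adj ell2_inner_commute by metis
    also have "ell2_inner (T (S x)) x = ell2_inner (S x) (S x)"
      using x S adj by blast
    finally show ?thesis using x S T by (simp add: ell2_inner_self)
  qed
  then show ?thesis
    by (simp add: hyponormal_def bd ell2_op_ge_def nonneg_Reals_of_real_iff del: of_real_diff)
qed

section \<open>Polynomials in a weighted shift\<close>

text \<open>The powers of a weighted shift are of the form \<open>rshift m g\<close>, and \<open>lshift m g\<close> is the adjoint of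
  \<open>rshift m g\<close>.\<close>

definition rshift :: "nat \<Rightarrow> (nat \<Rightarrow> real) \<Rightarrow> ell2_op" where
  "rshift m g x = (\<lambda>n. if n < m then 0 else of_real (g (n - m)) * x (n - m))"

definition lshift :: "nat \<Rightarrow> (nat \<Rightarrow> real) \<Rightarrow> ell2_op" where
  "lshift m g x = (\<lambda>n. of_real (g n) * x (n + m))"

lemma rshift_ell2:
  assumes "x \<in> ell2" "\<And>n. \<bar>g n\<bar> \<le> M"
  shows "rshift m g x \<in> ell2"
    and "(\<Sum>n. (cmod (rshift m g x n))\<^sup>2) \<le> M\<^sup>2 * (\<Sum>n. (cmod (x n))\<^sup>2)"
proof -
  let ?f = "\<lambda>n. (cmod (rshift m g x n))\<^sup>2"
  have x: "summable (\<lambda>n. M\<^sup>2 * (cmod (x n))\<^sup>2)"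
    using assms by (simp add: ell2_def summable_mult)
  have le: "?f (n + m) \<le> M\<^sup>2 * (cmod (x n))\<^sup>2" for n
    using assms(2)[of n] power_mono[of "\<bar>g n\<bar>" M 2]
    by (auto simp: rshift_def norm_mult power_mult_distrib intro!: mult_right_mono)
  have sm: "summable (\<lambda>n. ?f (n + m))"
    using x by (rule summable_comparison_test') (use le in auto)
  then have s: "summable ?f" by (simp only: summable_iff_shift[of ?f])
  then show "rshift m g x \<in> ell2" by (simp add: ell2_def)
  have "(\<Sum>n. ?f n) = (\<Sum>n. ?f (n + m))"
    using suminf_split_initial_segment[OF s, of m] by (simp add: rshift_def)
  also have "\<dots> \<le> (\<Sum>n. M\<^sup>2 * (cmod (x n))\<^sup>2)"
    using le sm x by (rule suminf_le)
  also have "\<dots> = M\<^sup>2 * (\<Sum>n. (cmod (x n))\<^sup>2)"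
    using assms by (simp add: ell2_def suminf_mult)
  finally show "(\<Sum>n. ?f n) \<le> M\<^sup>2 * (\<Sum>n. (cmod (x n))\<^sup>2)" .
qed

lemma lshift_ell2:
  assumes "x \<in> ell2" "\<And>n. \<bar>g n\<bar> \<le> M"
  shows "lshift m g x \<in> ell2"
proof -
  have "summable (\<lambda>n. (cmod (x n))\<^sup>2)" using assms(1) by (simp add: ell2_def)
  then have "summable (\<lambda>n. (cmod (x (n + m)))\<^sup>2)"
    by (simp only: summable_iff_shift[of "\<lambda>n. (cmod (x n))\<^sup>2" m])
  then have s: "summable (\<lambda>n. M\<^sup>2 * (cmod (x (n + m)))\<^sup>2)" by (rule summable_mult)
  have le: "(cmod (lshift m g x n))\<^sup>2 \<le> M\<^sup>2 * (cmod (x (n + m)))\<^sup>2" for n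
  proof -
    have "\<bar>g n\<bar>\<^sup>2 \<le> M\<^sup>2" using assms(2)[of n] by (intro power_mono) auto
    then show ?thesis by (simp add: lshift_def norm_mult power_mult_distrib mult_right_mono)
  qed
  have "summable (\<lambda>n. (cmod (lshift m g x n))\<^sup>2)"
    using s by (rule summable_comparison_test') (use le in simp)
  then show ?thesis by (simp add: ell2_def)
qed

lemma ell2_inner_rshift:
  assumes "x \<in> ell2" "y \<in> ell2" "\<And>n. \<bar>g n\<bar> \<le> M"
  shows "ell2_inner (rshift m g x) y = (\<Sum>n. of_real (g n) * x n * cnj (y (n + m)))"
proof -
  have s: "summable (\<lambda>n. rshift m g x n * cnj (y n))"
    using assms by (intro ell2_inner_summable rshift_ell2)
  show ?thesis
    unfolding ell2_inner_def suminf_split_initial_segment[OF s, of m]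
    by (simp add: rshift_def)
qed

lemma ell2_inner_rshift_lshift:
  assumes "x \<in> ell2" "y \<in> ell2" "\<And>n. \<bar>g n\<bar> \<le> M"
  shows "ell2_inner (rshift m g x) y = ell2_inner x (lshift m g y)"
  unfolding ell2_inner_rshift[OF assms] by (simp add: ell2_inner_def lshift_def mult_ac)

definition shift_power_weight :: "(nat \<Rightarrow> real) \<Rightarrow> nat \<Rightarrow> nat \<Rightarrow> real" where
  "shift_power_weight \<alpha> m n = (\<Prod>j<m. \<alpha> (n + j))"

lemma weighted_shift_power: "weighted_shift \<alpha> ^^ m = rshift m (shift_power_weight \<alpha> m)"
proof (induction m)
  case 0
  show ?case by (auto simp: rshift_def shift_power_weight_def)
next
  case (Suc m)
  show ?case
  proof (intro ext)
    fix x n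
    show "(weighted_shift \<alpha> ^^ Suc m) x n = rshift (Suc m) (shift_power_weight \<alpha> (Suc m)) x n"
      unfolding funpow.simps o_apply Suc
      by (cases n) (auto simp: rshift_def weighted_shift_def shift_power_weight_def)
  qed
qed

text \<open>With \<open>m = 2\<close> these are the polynomials of degree at most two, and with \<open>m = 3\<close>, \<open>a = 0\<close>,
  \<open>b = 1\<close> the operators \<open>T + s T\<^sup>3\<close>; both kinds of hyponormality are treated through them.\<close>

definition shift_trinomial :: "(nat \<Rightarrow> real) \<Rightarrow> nat \<Rightarrow> complex \<Rightarrow> complex \<Rightarrow> complex \<Rightarrow> ell2_op" where
  "shift_trinomial \<alpha> m a b c x =
     (\<lambda>n. a * x n + b * weighted_shift \<alpha> x n + c * (weighted_shift \<alpha> ^^ m) x n)"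

text \<open>For the shift \<open>W\<close> with weights \<open>\<alpha>\<close> and its adjoint \<open>V\<close>, \<open>diag_gap \<alpha> m\<close> is the diagonal of
  \<open>V\<^sup>m W\<^sup>m - W\<^sup>m V\<^sup>m\<close>, and \<open>cross_gap \<alpha> r\<close> is the only nonzero diagonal, at distance \<open>r\<close> from the main
  one, of \<open>V W\<^bsup>r+1\<^esup> - W\<^bsup>r+1\<^esup> V\<close>. A weight with negative index counts as \<open>0\<close>.\<close>

definition diag_gap :: "(nat \<Rightarrow> real) \<Rightarrow> nat \<Rightarrow> nat \<Rightarrow> real" where
  "diag_gap \<alpha> m n = (shift_power_weight \<alpha> m n)\<^sup>2 - (if n < m then 0 else (shift_power_weight \<alpha> m (n - m))\<^sup>2)"

definition cross_gap :: "(nat \<Rightarrow> real) \<Rightarrow> nat \<Rightarrow> nat \<Rightarrow> real" where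
  "cross_gap \<alpha> r n = ((\<alpha> (n + r))\<^sup>2 - (if n = 0 then 0 else (\<alpha> (n - 1))\<^sup>2)) * shift_power_weight \<alpha> r n"

definition gap_form :: "(nat \<Rightarrow> real) \<Rightarrow> nat \<Rightarrow> complex \<Rightarrow> complex \<Rightarrow> (nat \<Rightarrow> complex) \<Rightarrow> real" where
  "gap_form \<alpha> r b c x = (cmod b)\<^sup>2 * (\<Sum>n. diag_gap \<alpha> 1 n * (cmod (x n))\<^sup>2)
     + (cmod c)\<^sup>2 * (\<Sum>n. diag_gap \<alpha> (Suc r) n * (cmod (x n))\<^sup>2)
     + 2 * Re (b * cnj c * (\<Sum>n. of_real (cross_gap \<alpha> r n) * x (n + r) * cnj (x n)))"

context
  fixes \<alpha> :: "nat \<Rightarrow> real" and M :: real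
  assumes wbd: "\<forall>n. \<bar>\<alpha> n\<bar> \<le> M"
begin

lemma shift_power_weight_bound: "\<bar>shift_power_weight \<alpha> m n\<bar> \<le> M ^ m"
proof -
  have "\<bar>shift_power_weight \<alpha> m n\<bar> = (\<Prod>j<m. \<bar>\<alpha> (n + j)\<bar>)"
    by (simp add: shift_power_weight_def abs_prod)
  also have "\<dots> \<le> (\<Prod>j<m. M)" by (rule prod_mono) (simp add: wbd[rule_format])
  finally show ?thesis by simp
qed

lemma power_shift_ell2: "x \<in> ell2 \<Longrightarrow> (weighted_shift \<alpha> ^^ m) x \<in> ell2"
  unfolding weighted_shift_power by (rule rshift_ell2(1)[OF _ shift_power_weight_bound[of m]])

lemma lshift_weight_ell2: "x \<in> ell2 \<Longrightarrow> lshift m (shift_power_weight \<alpha> m) x \<in> ell2"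
  by (rule lshift_ell2[OF _ shift_power_weight_bound[of m]])

lemma power_shift_adjoint:
  "x \<in> ell2 \<Longrightarrow> y \<in> ell2 \<Longrightarrow>
    ell2_inner ((weighted_shift \<alpha> ^^ m) x) y = ell2_inner x (lshift m (shift_power_weight \<alpha> m) y)"
  unfolding weighted_shift_power by (rule ell2_inner_rshift_lshift[OF _ _ shift_power_weight_bound[of m]])

lemma bounded_shift_trinomial: "bounded_ell2_op (shift_trinomial \<alpha> m a b c)"
proof (rule bounded_ell2_opI)
  let ?V = "\<lambda>j. weighted_shift \<alpha> ^^ j" and ?s = "\<lambda>x. \<Sum>n. (cmod (x n))\<^sup>2"
  have eq: "shift_trinomial \<alpha> m a b c x = (\<lambda>n. a * x n + b * ?V 1 x n + c * ?V m x n)" for x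
    by (simp add: shift_trinomial_def)
  show mem: "shift_trinomial \<alpha> m a b c x \<in> ell2" if "x \<in> ell2" for x
    unfolding eq using that by (intro ell2_add ell2_scale power_shift_ell2)
  show "shift_trinomial \<alpha> m a b c (\<lambda>n. p * x n + q * y n)
      = (\<lambda>n. p * shift_trinomial \<alpha> m a b c x n + q * shift_trinomial \<alpha> m a b c y n)" for x y p q
    unfolding eq weighted_shift_power by (auto simp: rshift_def algebra_simps)
  show "?s (shift_trinomial \<alpha> m a b c x) \<le>
      (3 * (cmod a)\<^sup>2 + 3 * (cmod b)\<^sup>2 * (M ^ 1)\<^sup>2 + 3 * (cmod c)\<^sup>2 * (M ^ m)\<^sup>2) * ?s x"
    if x: "x \<in> ell2" for x
  proof -
    have sV: "(\<lambda>n. (cmod (?V j x n))\<^sup>2) sums ?s (?V j x)" for j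
      using power_shift_ell2[OF x, of j] by (simp add: ell2_def summable_sums)
    have sx: "(\<lambda>n. (cmod (x n))\<^sup>2) sums ?s x"
      using x by (simp add: ell2_def summable_sums)
    have dom: "(\<lambda>n. 3 * (cmod a)\<^sup>2 * (cmod (x n))\<^sup>2
        + 3 * (cmod b)\<^sup>2 * (cmod (?V 1 x n))\<^sup>2 + 3 * (cmod c)\<^sup>2 * (cmod (?V m x n))\<^sup>2) sums
        (3 * (cmod a)\<^sup>2 * ?s x + 3 * (cmod b)\<^sup>2 * ?s (?V 1 x) + 3 * (cmod c)\<^sup>2 * ?s (?V m x))"
      by (intro sums_add sums_mult sx sV)
    have bV: "?s (?V j x) \<le> (M ^ j)\<^sup>2 * ?s x" for j
      unfolding weighted_shift_power by (rule rshift_ell2(2)[OF x shift_power_weight_bound[of j]])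
    have three: "(cmod (p + q + r))\<^sup>2 \<le> 3 * (cmod p)\<^sup>2 + 3 * (cmod q)\<^sup>2 + 3 * (cmod r)\<^sup>2" for p q r
    proof -
      have "(cmod (p + q + r))\<^sup>2 \<le> (cmod p + cmod q + cmod r)\<^sup>2"
        by (intro power_mono norm_triangle_mono norm_triangle_ineq) auto
      also have "\<dots> \<le> 3 * (cmod p)\<^sup>2 + 3 * (cmod q)\<^sup>2 + 3 * (cmod r)\<^sup>2"
        using sum_squares_bound[of "cmod p" "cmod q"] sum_squares_bound[of "cmod p" "cmod r"]
          sum_squares_bound[of "cmod q" "cmod r"] by (simp add: power2_eq_square algebra_simps)
      finally show ?thesis .
    qed
    have "?s (shift_trinomial \<alpha> m a b c x) \<le> (\<Sum>n. 3 * (cmod a)\<^sup>2 * (cmod (x n))\<^sup>2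
        + 3 * (cmod b)\<^sup>2 * (cmod (?V 1 x n))\<^sup>2 + 3 * (cmod c)\<^sup>2 * (cmod (?V m x n))\<^sup>2)"
    proof (rule suminf_le)
      fix n
      show "(cmod (shift_trinomial \<alpha> m a b c x n))\<^sup>2 \<le> 3 * (cmod a)\<^sup>2 * (cmod (x n))\<^sup>2
        + 3 * (cmod b)\<^sup>2 * (cmod (?V 1 x n))\<^sup>2 + 3 * (cmod c)\<^sup>2 * (cmod (?V m x n))\<^sup>2"
        using three[of "a * x n" "b * ?V 1 x n" "c * ?V m x n"]
        by (simp add: eq norm_mult power_mult_distrib mult.assoc)
    next
      show "summable (\<lambda>n. (cmod (shift_trinomial \<alpha> m a b c x n))\<^sup>2)"
        using mem[OF x] by (simp add: ell2_def)
    next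
      show "summable (\<lambda>n. 3 * (cmod a)\<^sup>2 * (cmod (x n))\<^sup>2
        + 3 * (cmod b)\<^sup>2 * (cmod (?V 1 x n))\<^sup>2 + 3 * (cmod c)\<^sup>2 * (cmod (?V m x n))\<^sup>2)"
        using dom by (rule sums_summable)
    qed
    also have "\<dots> = 3 * (cmod a)\<^sup>2 * ?s x + 3 * (cmod b)\<^sup>2 * ?s (?V 1 x) + 3 * (cmod c)\<^sup>2 * ?s (?V m x)"
      using dom by (rule sums_unique[symmetric])
    also have "\<dots> \<le> 3 * (cmod a)\<^sup>2 * ?s x + 3 * (cmod b)\<^sup>2 * ((M ^ 1)\<^sup>2 * ?s x)
        + 3 * (cmod c)\<^sup>2 * ((M ^ m)\<^sup>2 * ?s x)"
      by (intro add_mono mult_left_mono bV) auto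
    finally show ?thesis by (simp add: algebra_simps)
  qed
qed

end

lemma Re_ell2_inner_trinomial:
  assumes "x \<in> ell2" "y \<in> ell2" "z \<in> ell2"
  shows "Re (ell2_inner (\<lambda>n. a * x n + b * y n + c * z n) (\<lambda>n. a * x n + b * y n + c * z n)) =
    (cmod a)\<^sup>2 * Re (ell2_inner x x) + (cmod b)\<^sup>2 * Re (ell2_inner y y) + (cmod c)\<^sup>2 * Re (ell2_inner z z)
    + 2 * Re (a * cnj b * ell2_inner x y) + 2 * Re (a * cnj c * ell2_inner x z)
    + 2 * Re (b * cnj c * ell2_inner y z)"
proof -
  have e: "ell2_inner y x = cnj (ell2_inner x y)" "ell2_inner z x = cnj (ell2_inner x z)"
    "ell2_inner z y = cnj (ell2_inner y z)"
    using assms ell2_inner_commute by blast+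
  have r: "Im (ell2_inner x x) = 0" "Im (ell2_inner y y) = 0" "Im (ell2_inner z z) = 0"
    using assms by (simp_all add: ell2_inner_self)
  show ?thesis
    using assms
    by (simp add: ell2_add ell2_scale ell2_inner_add_left ell2_inner_add_right ell2_inner_scale_left
        ell2_inner_scale_right e r cmod_power2)
       (simp add: power2_eq_square algebra_simps)
qed

context
  fixes \<alpha> :: "nat \<Rightarrow> real" and M :: real
  assumes wbd: "\<forall>n. \<bar>\<alpha> n\<bar> \<le> M"
begin

lemma diag_gap_sums:
  fixes m
  assumes x: "x \<in> ell2"
  defines "V \<equiv> (weighted_shift \<alpha> ^^ m) x" and "L \<equiv> lshift m (shift_power_weight \<alpha> m) x"
  shows "(\<lambda>n. diag_gap \<alpha> m n * (cmod (x n))\<^sup>2) sums (Re (ell2_inner V V) - Re (ell2_inner L L))"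
proof -
  let ?g = "shift_power_weight \<alpha> m"
  have V: "V \<in> ell2" and L: "L \<in> ell2"
    unfolding V_def L_def using x power_shift_ell2[OF wbd] lshift_weight_ell2[OF wbd] by auto
  have sV: "(\<lambda>n. (cmod (V n))\<^sup>2) sums Re (ell2_inner V V)"
    using V by (simp add: ell2_inner_self summable_sums) (simp add: ell2_def summable_sums)
  have sL: "(\<lambda>n. (cmod (L n))\<^sup>2) sums Re (ell2_inner L L)"
    using L by (simp add: ell2_inner_self summable_sums) (simp add: ell2_def summable_sums)
  let ?f = "\<lambda>n. if n < m then 0 else (?g (n - m))\<^sup>2 * (cmod (x n))\<^sup>2"
  have "(\<lambda>n. (cmod (V (n + m)))\<^sup>2) sums Re (ell2_inner V V)"
    using sV sums_iff_shift[of "\<lambda>n. (cmod (V n))\<^sup>2" m "Re (ell2_inner V V)"]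
    by (simp add: V_def weighted_shift_power rshift_def)
  then have s1: "(\<lambda>n. (?g n)\<^sup>2 * (cmod (x n))\<^sup>2) sums Re (ell2_inner V V)"
    by (simp add: V_def weighted_shift_power rshift_def norm_mult power_mult_distrib)
  have "(\<lambda>n. ?f (n + m)) sums Re (ell2_inner L L)"
    using sL by (simp add: L_def lshift_def norm_mult power_mult_distrib)
  then have s2: "?f sums Re (ell2_inner L L)"
    using sums_iff_shift[of ?f m "Re (ell2_inner L L)"] by simp
  show ?thesis
    using sums_diff[OF s1 s2]
    by (rule back_subst[where P = "\<lambda>f. f sums _"]) (auto simp: diag_gap_def algebra_simps)
qed

lemma cross_gap_sums:
  assumes x: "x \<in> ell2"
  shows "(\<lambda>n. of_real (cross_gap \<alpha> r n) * x (n + r) * cnj (x n)) sums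
    (ell2_inner ((weighted_shift \<alpha> ^^ 1) x) ((weighted_shift \<alpha> ^^ Suc r) x)
     - ell2_inner (lshift (Suc r) (shift_power_weight \<alpha> (Suc r)) x) (lshift 1 (shift_power_weight \<alpha> 1) x))"
proof -
  let ?V = "\<lambda>j. (weighted_shift \<alpha> ^^ j) x" and ?L = "\<lambda>j. lshift j (shift_power_weight \<alpha> j) x"
  let ?g = "shift_power_weight \<alpha> r"
  have wt1: "shift_power_weight \<alpha> (Suc r) n = \<alpha> (n + r) * ?g n" for n
    by (simp add: shift_power_weight_def)
  have wt2: "shift_power_weight \<alpha> (Suc r) n = \<alpha> n * ?g (Suc n)" for n
    unfolding shift_power_weight_def by (subst prod.lessThan_Suc_shift) simp
  have wt0: "shift_power_weight \<alpha> (Suc 0) n = \<alpha> n" for n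
    by (simp add: shift_power_weight_def)
  have V: "?V j \<in> ell2" and L: "?L j \<in> ell2" for j
    using x power_shift_ell2[OF wbd] lshift_weight_ell2[OF wbd] by auto
  let ?I = "ell2_inner (?V 1) (?V (Suc r))" and ?J = "ell2_inner (?L (Suc r)) (?L 1)"
  have sV: "(\<lambda>n. ?V 1 n * cnj (?V (Suc r) n)) sums ?I"
    unfolding ell2_inner_def by (rule summable_sums[OF ell2_inner_summable[OF V V]])
  have sL: "(\<lambda>n. ?L (Suc r) n * cnj (?L 1 n)) sums ?J"
    unfolding ell2_inner_def by (rule summable_sums[OF ell2_inner_summable[OF L L]])
  have "(\<lambda>n. ?V 1 (n + Suc r) * cnj (?V (Suc r) (n + Suc r))) sums ?I"
    using sV sums_iff_shift[of "\<lambda>n. ?V 1 n * cnj (?V (Suc r) n)" "Suc r" ?I]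
    unfolding weighted_shift_power by (simp add: rshift_def)
  then have s1: "(\<lambda>n. of_real ((\<alpha> (n + r))\<^sup>2 * ?g n) * x (n + r) * cnj (x n)) sums ?I"
    unfolding weighted_shift_power
    by (simp add: rshift_def wt0 wt1 power2_eq_square mult_ac)
  let ?f = "\<lambda>n. of_real (if n = 0 then 0 else (\<alpha> (n - 1))\<^sup>2 * ?g n) * x (n + r) * cnj (x n)"
  have "(\<lambda>n. ?f (n + 1)) sums ?J"
    using sL by (simp add: lshift_def wt0 wt2 power2_eq_square mult_ac)
  then have s2: "?f sums ?J"
    using sums_iff_shift[of ?f 1 ?J] by simp
  show ?thesis
    using sums_diff[OF s1 s2]
    by (rule back_subst[where P = "\<lambda>f. f sums _"]) (auto simp: cross_gap_def algebra_simps)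
qed

text \<open>The constant term \<open>a\<close> cancels between \<open>\<parallel>T x\<parallel>\<^sup>2\<close> and the norm of the adjoint, since
  \<open>\<langle>x, W\<^sup>j x\<rangle>\<close> and \<open>\<langle>x, V\<^sup>j x\<rangle>\<close>, with \<open>V\<close> the adjoint of \<open>W\<close>, are complex conjugates. What remains
  couples only entries of \<open>x\<close> at distance \<open>r\<close>.\<close>

lemma hyponormal_shift_trinomial:
  "hyponormal (shift_trinomial \<alpha> (Suc r) a b c) \<longleftrightarrow> (\<forall>x\<in>ell2. 0 \<le> gap_form \<alpha> r b c x)"
proof -
  let ?V = "\<lambda>j x. (weighted_shift \<alpha> ^^ j) x" and ?L = "\<lambda>j x. lshift j (shift_power_weight \<alpha> j) x"
  let ?T = "shift_trinomial \<alpha> (Suc r) a b c"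
  define S where "S = (\<lambda>x n. cnj a * x n + cnj b * ?L 1 x n + cnj c * ?L (Suc r) x n)"
  have T: "?T x = (\<lambda>n. a * x n + b * ?V 1 x n + c * ?V (Suc r) x n)" for x
    by (simp add: shift_trinomial_def)
  have V: "?V j x \<in> ell2" and L: "?L j x \<in> ell2" if "x \<in> ell2" for j x
    using that power_shift_ell2[OF wbd] lshift_weight_ell2[OF wbd] by auto
  have adj: "ell2_inner (?V j x) y = ell2_inner x (?L j y)" if "x \<in> ell2" "y \<in> ell2" for j x y
    using that power_shift_adjoint[OF wbd] by auto
  have "hyponormal ?T \<longleftrightarrow>
    (\<forall>x\<in>ell2. 0 \<le> Re (ell2_inner (?T x) (?T x)) - Re (ell2_inner (S x) (S x)))"
  proof (rule hyponormal_iff_norms)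
    show "bounded_ell2_op ?T" by (rule bounded_shift_trinomial[OF wbd])
    show "S y \<in> ell2" if "y \<in> ell2" for y
      unfolding S_def using that by (intro ell2_add ell2_scale L)
    show "ell2_inner (?T x) y = ell2_inner x (S y)" if "x \<in> ell2" "y \<in> ell2" for x y
      unfolding T S_def using that V[OF that(1)] L[OF that(2)] adj[OF that]
      by (simp add: ell2_add ell2_scale ell2_inner_add_left ell2_inner_add_right
          ell2_inner_scale_left ell2_inner_scale_right del: funpow.simps One_nat_def)
  qed
  moreover have "Re (ell2_inner (?T x) (?T x)) - Re (ell2_inner (S x) (S x)) = gap_form \<alpha> r b c x"
    if x: "x \<in> ell2" for x
  proof -
    have swap: "ell2_inner x (?L j x) = cnj (ell2_inner x (?V j x))" for j
      using x V[OF x] adj[OF x x] ell2_inner_commute by metis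
    have "ell2_inner (?L 1 x) (?L (Suc r) x) = cnj (ell2_inner (?L (Suc r) x) (?L 1 x))"
      using ell2_inner_commute[OF L[OF x] L[OF x]] by blast
    then have "Re (ell2_inner (?T x) (?T x)) - Re (ell2_inner (S x) (S x)) =
        (cmod b)\<^sup>2 * (Re (ell2_inner (?V 1 x) (?V 1 x)) - Re (ell2_inner (?L 1 x) (?L 1 x)))
        + (cmod c)\<^sup>2 * (Re (ell2_inner (?V (Suc r) x) (?V (Suc r) x)) - Re (ell2_inner (?L (Suc r) x) (?L (Suc r) x)))
        + 2 * Re (b * cnj c * (ell2_inner (?V 1 x) (?V (Suc r) x) - ell2_inner (?L (Suc r) x) (?L 1 x)))"
      unfolding T S_def Re_ell2_inner_trinomial[OF x V[OF x] V[OF x]]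
        Re_ell2_inner_trinomial[OF x L[OF x] L[OF x]] swap
      by (simp add: algebra_simps del: funpow.simps One_nat_def)
    also have "\<dots> = gap_form \<alpha> r b c x"
      using diag_gap_sums[OF x, of 1, THEN sums_unique] diag_gap_sums[OF x, of "Suc r", THEN sums_unique]
        cross_gap_sums[OF x, of r, THEN sums_unique]
      by (simp only: gap_form_def)
    finally show ?thesis .
  qed
  ultimately show ?thesis by simp
qed

end

section \<open>Reduction to finite real sections\<close>

text \<open>The truncation of the commutator form for \<open>b = 1\<close> and \<open>c = - sqrt t\<close>. That choice of phase makes
  the cross terms as unfavourable as possible at nonnegative vectors.\<close>

definition section_form :: "(nat \<Rightarrow> real) \<Rightarrow> nat \<Rightarrow> real \<Rightarrow> nat \<Rightarrow> (nat \<Rightarrow> real) \<Rightarrow> real" where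
  "section_form \<alpha> r t N z =
     (\<Sum>n<N + r. (diag_gap \<alpha> 1 n + t * diag_gap \<alpha> (Suc r) n) * (z n)\<^sup>2)
     - 2 * sqrt t * (\<Sum>n<N. cross_gap \<alpha> r n * z n * z (n + r))"

lemma section_form_of_hyponormal:
  assumes wbd: "\<forall>n. \<bar>\<alpha> n\<bar> \<le> M"
    and hyp: "\<And>s. hyponormal (shift_trinomial \<alpha> (Suc r) 0 1 s)" and t: "0 < t"
  shows "0 \<le> section_form \<alpha> r t N z"
proof -
  define x where "x = (\<lambda>n. complex_of_real (if n < N + r then z n else 0))"
  have "summable (\<lambda>n. (cmod (x n))\<^sup>2)"
    by (rule summable_finite[of "{..<N + r}"]) (auto simp: x_def)
  then have x: "x \<in> ell2" by (simp add: ell2_def)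
  have d: "(\<Sum>n. diag_gap \<alpha> m n * (cmod (x n))\<^sup>2) = (\<Sum>n<N + r. diag_gap \<alpha> m n * (z n)\<^sup>2)" for m
    by (subst suminf_finite[of "{..<N + r}"]) (auto simp: x_def)
  have c: "(\<Sum>n. of_real (cross_gap \<alpha> r n) * x (n + r) * cnj (x n)) =
      of_real (\<Sum>n<N. cross_gap \<alpha> r n * z n * z (n + r))"
    by (subst suminf_finite[of "{..<N}"]) (auto simp: x_def mult_ac)
  have "0 \<le> gap_form \<alpha> r 1 (of_real (- sqrt t)) x"
    using hyp hyponormal_shift_trinomial[OF wbd] x by blast
  also have "gap_form \<alpha> r 1 (of_real (- sqrt t)) x = section_form \<alpha> r t N z"
    unfolding gap_form_def d c section_form_def
    using t by (simp add: sum_distrib_left sum.distrib[symmetric] distrib_right algebra_simps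
        del: of_real_sum One_nat_def)
  finally show ?thesis .
qed

text \<open>The cross term is bounded by its value at the moduli of the entries, so only the real form with
  \<open>t = (cmod c / cmod b)\<^sup>2\<close> matters; if \<open>b\<close> or \<open>c\<close> vanishes, the form is diagonal. Positivity passes
  from the sections to the limit.\<close>

lemma hyponormal_of_section_form:
  assumes wbd: "\<forall>n. \<bar>\<alpha> n\<bar> \<le> M"
    and dpos: "\<And>n. 0 \<le> diag_gap \<alpha> 1 n" "\<And>n. 0 \<le> diag_gap \<alpha> (Suc r) n"
    and cpos: "\<And>n. 0 \<le> cross_gap \<alpha> r n"
    and sec: "\<And>t N z. 0 < t \<Longrightarrow> (\<And>n. 0 \<le> z n) \<Longrightarrow> 0 \<le> section_form \<alpha> r t N z"
  shows "hyponormal (shift_trinomial \<alpha> (Suc r) a b c)"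
  unfolding hyponormal_shift_trinomial[OF wbd]
proof
  fix x :: "nat \<Rightarrow> complex" assume x: "x \<in> ell2"
  define z where "z = (\<lambda>n. cmod (x n))"
  define p q where "p = cmod b" and "q = cmod c"
  have z0: "0 \<le> z n" for n by (simp add: z_def)
  have pq: "0 \<le> p" "0 \<le> q" by (simp_all add: p_def q_def)
  let ?D = "\<lambda>m K. \<Sum>n<K. diag_gap \<alpha> m n * (z n)\<^sup>2"
  let ?X = "\<lambda>N. \<Sum>n<N. of_real (cross_gap \<alpha> r n) * x (n + r) * cnj (x n)"
  let ?C = "\<lambda>N. \<Sum>n<N. cross_gap \<alpha> r n * z n * z (n + r)"
  have fin: "0 \<le> p\<^sup>2 * ?D 1 (N + r) + q\<^sup>2 * ?D (Suc r) (N + r) - 2 * p * q * ?C N" for N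
  proof -
    have D0: "0 \<le> ?D 1 K" "0 \<le> ?D (Suc r) K" for K
      using dpos by (auto intro!: sum_nonneg mult_nonneg_nonneg)
    show ?thesis
    proof (cases "p = 0 \<or> q = 0")
      case True
      then show ?thesis using D0 by auto
    next
      case False
      then have pos: "0 < p" "0 < q" using pq by auto
      let ?t = "(q / p)\<^sup>2"
      have "0 \<le> p\<^sup>2 * section_form \<alpha> r ?t N z"
        using sec[of ?t z N] pos z0 by simp
      also have "\<dots> = p\<^sup>2 * (?D 1 (N + r) + ?t * ?D (Suc r) (N + r) - 2 * (q / p) * ?C N)"
        using pos by (simp add: section_form_def real_sqrt_abs sum_distrib_left sum.distrib[symmetric] algebra_simps
            del: One_nat_def)
      also have "\<dots> = p\<^sup>2 * ?D 1 (N + r) + q\<^sup>2 * ?D (Suc r) (N + r) - 2 * p * q * ?C N"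
        using pos by (simp add: field_simps power2_eq_square del: One_nat_def)
      finally show ?thesis .
    qed
  qed
  have lower: "- (p * q * ?C N) \<le> Re (b * cnj c * ?X N)" for N
  proof -
    have "cmod (b * cnj c * ?X N) \<le> p * q * ?C N"
      unfolding norm_mult p_def q_def complex_mod_cnj
    proof (intro mult_left_mono mult_nonneg_nonneg norm_ge_zero)
      show "cmod (?X N) \<le> ?C N"
        by (rule sum_norm_le) (simp add: norm_mult z_def abs_of_nonneg[OF cpos] mult_ac)
    qed
    then show ?thesis using abs_Re_le_cmod[of "b * cnj c * ?X N"] by linarith
  qed
  have lim: "(\<lambda>N. p\<^sup>2 * ?D 1 (N + r) + q\<^sup>2 * ?D (Suc r) (N + r) + 2 * Re (b * cnj c * ?X N))
      \<longlonglongrightarrow> gap_form \<alpha> r b c x"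
  proof -
    have D: "?D m \<longlonglongrightarrow> (\<Sum>n. diag_gap \<alpha> m n * (cmod (x n))\<^sup>2)" for m
      using summable_sums[OF sums_summable[OF diag_gap_sums[OF wbd x]], of m]
      by (simp only: sums_def z_def)
    have D': "(\<lambda>N. ?D m (N + r)) \<longlonglongrightarrow> (\<Sum>n. diag_gap \<alpha> m n * (cmod (x n))\<^sup>2)" for m
      using D by (rule LIMSEQ_ignore_initial_segment)
    have X: "?X \<longlonglongrightarrow> (\<Sum>n. of_real (cross_gap \<alpha> r n) * x (n + r) * cnj (x n))"
      using summable_sums[OF sums_summable[OF cross_gap_sums[OF wbd x]], of r]
      by (simp only: sums_def)
    show ?thesis
      unfolding gap_form_def p_def[symmetric] q_def[symmetric]
      by (intro tendsto_add tendsto_mult tendsto_const tendsto_Re D' X)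
  qed
  show "0 \<le> gap_form \<alpha> r b c x"
    using lim
  proof (rule LIMSEQ_le_const, intro exI allI impI)
    fix N
    show "0 \<le> p\<^sup>2 * ?D 1 (N + r) + q\<^sup>2 * ?D (Suc r) (N + r) + 2 * Re (b * cnj c * ?X N)"
      using fin[of N] lower[of N] by linarith
  qed
qed

lemma poly_op_quadratic:
  assumes "degree p \<le> 2"
  shows "poly_op p (weighted_shift \<alpha>) = shift_trinomial \<alpha> 2 (coeff p 0) (coeff p 1) (coeff p 2)"
proof (intro ext)
  fix x n
  have "(\<Sum>i\<le>degree p. coeff p i * (weighted_shift \<alpha> ^^ i) x n)
      = (\<Sum>i\<le>2. coeff p i * (weighted_shift \<alpha> ^^ i) x n)"
    using assms by (intro sum.mono_neutral_left) (auto simp: coeff_eq_0)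
  also have "\<dots> = shift_trinomial \<alpha> 2 (coeff p 0) (coeff p 1) (coeff p 2) x n"
    by (simp add: shift_trinomial_def numeral_2_eq_2)
  finally show "poly_op p (weighted_shift \<alpha>) x n = \<dots>" by (simp add: poly_op_def)
qed

lemma quadratically_hyponormal_iff_sections:
  assumes wbd: "\<forall>n. \<bar>\<alpha> n\<bar> \<le> M"
    and pos: "\<And>n. 0 \<le> diag_gap \<alpha> 1 n" "\<And>n. 0 \<le> diag_gap \<alpha> 2 n" "\<And>n. 0 \<le> cross_gap \<alpha> 1 n"
  shows "quadratically_hyponormal (weighted_shift \<alpha>) \<longleftrightarrow>
    (\<forall>t>0. \<forall>N z. (\<forall>n. 0 \<le> z n) \<longrightarrow> 0 \<le> section_form \<alpha> 1 t N z)"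
proof
  assume Q: "quadratically_hyponormal (weighted_shift \<alpha>)"
  have "hyponormal (shift_trinomial \<alpha> (Suc 1) 0 1 s)" for s
  proof -
    have "degree [:0, 1, s:] \<le> 2" by (simp add: degree_pCons_le)
    then have "hyponormal (poly_op [:0, 1, s:] (weighted_shift \<alpha>))"
      using Q unfolding quadratically_hyponormal_def by blast
    then show ?thesis
      using poly_op_quadratic[OF \<open>degree [:0, 1, s:] \<le> 2\<close>] by (simp add: numeral_2_eq_2)
  qed
  then show "\<forall>t>0. \<forall>N z. (\<forall>n. 0 \<le> z n) \<longrightarrow> 0 \<le> section_form \<alpha> 1 t N z"
    using section_form_of_hyponormal[OF wbd] by blast
next
  assume "\<forall>t>0. \<forall>N z. (\<forall>n. 0 \<le> z n) \<longrightarrow> 0 \<le> section_form \<alpha> 1 t N z"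
  then have "hyponormal (shift_trinomial \<alpha> (Suc 1) a b c)" for a b c
    using pos by (intro hyponormal_of_section_form[OF wbd]) (simp_all only: Suc_1 simp_thms)
  then show "quadratically_hyponormal (weighted_shift \<alpha>)"
    unfolding quadratically_hyponormal_def by (metis Suc_1 poly_op_quadratic)
qed

lemma semi_cubically_hyponormal_iff_sections:
  assumes wbd: "\<forall>n. \<bar>\<alpha> n\<bar> \<le> M"
    and pos: "\<And>n. 0 \<le> diag_gap \<alpha> 1 n" "\<And>n. 0 \<le> diag_gap \<alpha> 3 n" "\<And>n. 0 \<le> cross_gap \<alpha> 2 n"
  shows "semi_cubically_hyponormal (weighted_shift \<alpha>) \<longleftrightarrow>
    (\<forall>t>0. \<forall>N z. (\<forall>n. 0 \<le> z n) \<longrightarrow> 0 \<le> section_form \<alpha> 2 t N z)"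
proof -
  have eq: "(\<lambda>x n. weighted_shift \<alpha> x n + s * (weighted_shift \<alpha> ^^ 3) x n)
      = shift_trinomial \<alpha> (Suc 2) 0 1 s" for s
    by (intro ext) (simp add: shift_trinomial_def eval_nat_numeral)
  show ?thesis
  proof
    assume "semi_cubically_hyponormal (weighted_shift \<alpha>)"
    then have "hyponormal (shift_trinomial \<alpha> (Suc 2) 0 1 s)" for s
      by (simp only: semi_cubically_hyponormal_def eq)
    then show "\<forall>t>0. \<forall>N z. (\<forall>n. 0 \<le> z n) \<longrightarrow> 0 \<le> section_form \<alpha> 2 t N z"
      using section_form_of_hyponormal[OF wbd] by blast
  next
    assume "\<forall>t>0. \<forall>N z. (\<forall>n. 0 \<le> z n) \<longrightarrow> 0 \<le> section_form \<alpha> 2 t N z"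
    then have "hyponormal (shift_trinomial \<alpha> (Suc 2) 0 1 s)" for s
      using pos by (intro hyponormal_of_section_form[OF wbd]) (simp_all add: eval_nat_numeral)
    then show "semi_cubically_hyponormal (weighted_shift \<alpha>)"
      unfolding semi_cubically_hyponormal_def eq by blast
  qed
qed

section \<open>Schur complements of chains\<close>

text \<open>The sum \<open>\<Sum>m\<le>N. \<Prod>i<m. t * \<rho> i\<close> in Horner form, which matches the elimination of the
  variables of a chain one after the other.\<close>

primrec ratio_sum :: "(nat \<Rightarrow> real) \<Rightarrow> real \<Rightarrow> nat \<Rightarrow> real" where
  "ratio_sum \<rho> t 0 = 1"
| "ratio_sum \<rho> t (Suc N) = 1 + t * \<rho> 0 * ratio_sum (\<lambda>i. \<rho> (Suc i)) t N"

lemma ratio_sum_ge_1: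
  assumes "0 \<le> t" "\<And>i. 0 \<le> \<rho> i" shows "1 \<le> ratio_sum \<rho> t N"
  using assms(2)
proof (induction N arbitrary: \<rho>)
  case (Suc N)
  have "1 \<le> ratio_sum (\<lambda>i. \<rho> (Suc i)) t N" using Suc by simp
  then show ?case using Suc.prems[of 0] assms(1) by simp
qed simp

lemma ratio_sum_cong:
  assumes "\<And>i. t * \<rho> i = t' * \<rho>' i" shows "ratio_sum \<rho> t N = ratio_sum \<rho>' t' N"
  using assms
proof (induction N arbitrary: \<rho> \<rho>')
  case (Suc N)
  have "ratio_sum (\<lambda>i. \<rho> (Suc i)) t N = ratio_sum (\<lambda>i. \<rho>' (Suc i)) t' N"
    by (rule Suc.IH) (rule Suc.prems)
  then show ?case using Suc.prems[of 0] by simp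
qed simp

lemma ratio_sum_mono:
  assumes "0 \<le> t" "\<And>i. 0 \<le> \<rho> i" "\<And>i. \<rho> i \<le> \<rho>' i" shows "ratio_sum \<rho> t N \<le> ratio_sum \<rho>' t N"
  using assms(2,3)
proof (induction N arbitrary: \<rho> \<rho>')
  case (Suc N)
  have "ratio_sum (\<lambda>i. \<rho> (Suc i)) t N \<le> ratio_sum (\<lambda>i. \<rho>' (Suc i)) t N"
    using Suc by simp
  moreover have "1 \<le> ratio_sum (\<lambda>i. \<rho> (Suc i)) t N"
    using assms(1) Suc.prems by (intro ratio_sum_ge_1) auto
  moreover have "0 \<le> \<rho>' 0" using Suc.prems[of 0] by linarith
  ultimately show ?case
    unfolding ratio_sum.simps using assms(1) Suc.prems[of 0]
    by (intro add_left_mono mult_mono mult_left_mono mult_nonneg_nonneg) auto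
qed simp

lemma ratio_sum_geometric_bound:
  assumes "0 \<le> t" "\<And>i. 0 \<le> \<rho> i" "\<And>i. \<rho> i \<le> L" "t * L < 1"
  shows "1 - t * L \<le> 1 / ratio_sum \<rho> t N"
proof -
  have "ratio_sum \<rho> t N \<le> 1 / (1 - t * L)"
    using assms(2,3)
  proof (induction N arbitrary: \<rho>)
    case 0
    have "0 \<le> L" using 0[of 0] by linarith
    then show ?case using assms(1,4) by (simp add: field_simps)
  next
    case (Suc N)
    have le: "ratio_sum (\<lambda>i. \<rho> (Suc i)) t N \<le> 1 / (1 - t * L)" using Suc by simp
    have ge: "1 \<le> ratio_sum (\<lambda>i. \<rho> (Suc i)) t N"
      using assms(1) Suc.prems by (intro ratio_sum_ge_1) auto
    have L: "0 \<le> L" using Suc.prems[of 0] by linarith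
    have "ratio_sum \<rho> t (Suc N) \<le> 1 + t * L * (1 / (1 - t * L))"
      unfolding ratio_sum.simps using le ge Suc.prems[of 0] assms(1) L
      by (intro add_left_mono mult_mono mult_left_mono) auto
    also have "\<dots> = 1 / (1 - t * L)" using assms(4) by (simp add: field_simps)
    finally show ?case .
  qed
  moreover have "1 \<le> ratio_sum \<rho> t N" using assms by (intro ratio_sum_ge_1)
  ultimately show ?thesis using assms(4) by (simp add: field_simps)
qed

text \<open>Once \<open>t * \<rho> i \<ge> 1\<close> the summands no longer decrease.\<close>

lemma ratio_sum_unbounded:
  assumes "0 < t" "\<And>i. 0 < \<rho> i" "\<And>i. i \<ge> n0 \<Longrightarrow> 1 \<le> t * \<rho> i"
  shows "\<exists>N. K < ratio_sum \<rho> t N"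
  using assms(2,3)
proof (induction n0 arbitrary: \<rho> K)
  case 0
  have "real N + 1 \<le> ratio_sum \<rho> t N" for N
    using 0
  proof (induction N arbitrary: \<rho>)
    case (Suc N)
    have "real N + 1 \<le> ratio_sum (\<lambda>i. \<rho> (Suc i)) t N" using Suc by simp
    then have "1 * (real N + 1) \<le> t * \<rho> 0 * ratio_sum (\<lambda>i. \<rho> (Suc i)) t N"
      using Suc.prems(2)[of 0] by (intro mult_mono) auto
    then show ?case by simp
  qed simp
  note lin = this
  obtain N where "K < real N" using reals_Archimedean2 by blast
  then have "K < ratio_sum \<rho> t N" using lin[of N] by linarith
  then show ?case ..
next
  case (Suc n0)
  have "\<exists>N. K / (t * \<rho> 0) < ratio_sum (\<lambda>i. \<rho> (Suc i)) t N"
    using Suc.prems by (intro Suc.IH) auto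
  then obtain N where "K / (t * \<rho> 0) < ratio_sum (\<lambda>i. \<rho> (Suc i)) t N" ..
  then have "K < ratio_sum \<rho> t (Suc N)"
    using Suc.prems(1)[of 0] assms(1) by (simp add: field_simps)
  then show ?case ..
qed

text \<open>A tridiagonal form with diagonal \<open>A n + t * B n\<close>, without the summand \<open>t * B 0\<close>, and with squared
  off-diagonal entries \<open>t * A n * B (n + 1)\<close>. With this off-diagonal it is the sum of the
  squares \<open>(sqrt (A n) * z n - sqrt (t * B (n + 1)) * z (n + 1))\<^sup>2\<close> for \<open>n < N\<close> and of \<open>A N * (z N)\<^sup>2\<close>.\<close>

primrec chain_form :: "(nat \<Rightarrow> real) \<Rightarrow> (nat \<Rightarrow> real) \<Rightarrow> real \<Rightarrow> nat \<Rightarrow> (nat \<Rightarrow> real) \<Rightarrow> real" where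
  "chain_form A B t 0 z = A 0 * (z 0)\<^sup>2"
| "chain_form A B t (Suc N) z = A 0 * (z 0)\<^sup>2 - 2 * sqrt t * sqrt (A 0 * B (Suc 0)) * z 0 * z (Suc 0)
     + t * B (Suc 0) * (z (Suc 0))\<^sup>2
     + chain_form (\<lambda>n. A (Suc n)) (\<lambda>n. B (Suc n)) t N (\<lambda>n. z (Suc n))"

lemma chain_form_eq_sum:
  "t * B 0 * (z 0)\<^sup>2 + chain_form A B t N z =
    (\<Sum>n<Suc N. (A n + t * B n) * (z n)\<^sup>2)
    - 2 * sqrt t * (\<Sum>n<N. sqrt (A n * B (Suc n)) * z n * z (Suc n))"
proof (induction N arbitrary: A B z)
  case 0
  show ?case by (simp add: algebra_simps)
next
  case (Suc N)
  show ?case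
    using Suc[of "\<lambda>n. B (Suc n)" "\<lambda>n. z (Suc n)" "\<lambda>n. A (Suc n)"]
    by (subst (1 2) sum.lessThan_Suc_shift) (simp add: algebra_simps)
qed

abbreviation chain_ratio_sum :: "(nat \<Rightarrow> real) \<Rightarrow> (nat \<Rightarrow> real) \<Rightarrow> real \<Rightarrow> nat \<Rightarrow> real" where
  "chain_ratio_sum A B \<equiv> ratio_sum (\<lambda>i. B (Suc i) / A (Suc i))"

lemma two_term_minimum:
  fixes a e w x y :: real
  assumes "0 < e"
  shows "a * x\<^sup>2 - 2 * w * x * y + e * y\<^sup>2 = (a - w\<^sup>2 / e) * x\<^sup>2 + e * (y - w / e * x)\<^sup>2"
  using assms by (simp add: field_simps power2_eq_square)

lemma chain_step:
  assumes "0 < A0" "0 < B1" "0 < A1" "0 < t" "0 < (S::real)"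
  shows "A0 * x\<^sup>2 - 2 * sqrt t * sqrt (A0 * B1) * x * y + t * B1 * y\<^sup>2 + A1 / S * y\<^sup>2
    = A0 / (1 + t * (B1 / A1) * S) * x\<^sup>2
      + (t * B1 + A1 / S) * (y - sqrt t * sqrt (A0 * B1) / (t * B1 + A1 / S) * x)\<^sup>2"
proof -
  let ?e = "t * B1 + A1 / S" and ?w = "sqrt t * sqrt (A0 * B1)"
  have e: "0 < ?e" using assms by (simp add: add_pos_pos)
  have w: "?w\<^sup>2 = t * (A0 * B1)" using assms by (simp add: power_mult_distrib)
  have eq: "A0 - ?w\<^sup>2 / ?e = A0 / (1 + t * (B1 / A1) * S)"
  proof -
    have "0 < A1 + S * (t * B1)" using assms by (simp add: add_pos_pos)
    then show ?thesis unfolding w using assms by (simp add: field_simps)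
  qed
  have "A0 * x\<^sup>2 - 2 * sqrt t * sqrt (A0 * B1) * x * y + t * B1 * y\<^sup>2 + A1 / S * y\<^sup>2
      = A0 * x\<^sup>2 - 2 * ?w * x * y + ?e * y\<^sup>2" by (simp only: distrib_right mult.assoc)
  also have "\<dots> = A0 / (1 + t * (B1 / A1) * S) * x\<^sup>2 + ?e * (y - ?w / ?e * x)\<^sup>2"
    unfolding two_term_minimum[OF e] eq ..
  finally show ?thesis .
qed

text \<open>The minimum over all later variables at fixed \<open>z 0\<close> is obtained by minimising over \<open>z 1\<close> after the
  tail has been replaced by its own minimum; this recursion is the one of \<^const>\<open>ratio_sum\<close>.\<close>

lemma chain_form_ge:
  assumes "0 < t" "\<And>n. 0 < A n" "\<And>n. 0 < B n"
  shows "A 0 / chain_ratio_sum A B t N * (z 0)\<^sup>2 \<le> chain_form A B t N z"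
  using assms(2,3)
proof (induction N arbitrary: A B z)
  case (Suc N)
  let ?S = "ratio_sum (\<lambda>i. B (Suc (Suc i)) / A (Suc (Suc i))) t N"
  have S: "0 < ?S"
    using ratio_sum_ge_1[of t "\<lambda>i. B (Suc (Suc i)) / A (Suc (Suc i))" N] Suc.prems assms(1)
    by (simp add: less_imp_le)
  have "A 1 / ?S * (z 1)\<^sup>2 \<le> chain_form (\<lambda>n. A (Suc n)) (\<lambda>n. B (Suc n)) t N (\<lambda>n. z (Suc n))"
    using Suc.IH[of "\<lambda>n. A (Suc n)" "\<lambda>n. B (Suc n)" "\<lambda>n. z (Suc n)"] Suc.prems by simp
  moreover have "0 \<le> (t * B 1 + A 1 / ?S)
      * (z 1 - sqrt t * sqrt (A 0 * B 1) / (t * B 1 + A 1 / ?S) * z 0)\<^sup>2"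
    using Suc.prems assms(1) S by (simp add: less_imp_le)
  ultimately show ?case
    using chain_step[OF Suc.prems(1)[of 0] Suc.prems(2)[of 1] Suc.prems(1)[of 1] assms(1) S, of "z 0" "z 1"]
    by simp
qed simp

lemma chain_form_nonneg:
  assumes "0 < t" "\<And>n. 0 < A n" "\<And>n. 0 < B n"
  shows "0 \<le> chain_form A B t N z"
proof -
  have "1 \<le> chain_ratio_sum A B t N" using assms by (intro ratio_sum_ge_1) (simp_all add: less_imp_le)
  then have "0 \<le> A 0 / chain_ratio_sum A B t N * (z 0)\<^sup>2" using assms(2)[of 0] by simp
  also have "\<dots> \<le> chain_form A B t N z" by (rule chain_form_ge[OF assms])
  finally show ?thesis .
qed

text \<open>All minimising coordinates have the sign of \<open>\<zeta>\<close>, so the bound is sharp already among nonnegative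
  vectors.\<close>

lemma chain_form_attained:
  assumes "0 < t" "\<And>n. 0 < A n" "\<And>n. 0 < B n" "0 \<le> \<zeta>"
  shows "\<exists>z. z 0 = \<zeta> \<and> (\<forall>n. 0 \<le> z n) \<and> chain_form A B t N z = A 0 / chain_ratio_sum A B t N * \<zeta>\<^sup>2"
  using assms(2-4)
proof (induction N arbitrary: A B \<zeta>)
  case 0
  show ?case using 0(3) by (intro exI[of _ "\<lambda>n. \<zeta>"]) simp
next
  case (Suc N)
  let ?S = "ratio_sum (\<lambda>i. B (Suc (Suc i)) / A (Suc (Suc i))) t N"
  have S: "0 < ?S"
    using ratio_sum_ge_1[of t "\<lambda>i. B (Suc (Suc i)) / A (Suc (Suc i))" N] Suc.prems assms(1)
    by (simp add: less_imp_le)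
  define y where "y = sqrt t * sqrt (A 0 * B 1) / (t * B 1 + A 1 / ?S) * \<zeta>"
  have "0 \<le> y" unfolding y_def using Suc.prems assms(1) S by (simp add: less_imp_le)
  then obtain z where z: "z 0 = y" "\<forall>n. 0 \<le> z n"
    "chain_form (\<lambda>n. A (Suc n)) (\<lambda>n. B (Suc n)) t N z = A 1 / ?S * y\<^sup>2"
    using Suc.IH[of "\<lambda>n. A (Suc n)" "\<lambda>n. B (Suc n)" y] Suc.prems by auto
  have zero: "y - sqrt t * sqrt (A 0 * B 1) / (t * B 1 + A 1 / ?S) * \<zeta> = 0" by (simp add: y_def)
  have "chain_form A B t (Suc N) (case_nat \<zeta> z) = A 0 / chain_ratio_sum A B t (Suc N) * \<zeta>\<^sup>2"
    using chain_step[OF Suc.prems(1)[of 0] Suc.prems(2)[of 1] Suc.prems(1)[of 1] assms(1) S, of \<zeta> y] z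
    unfolding zero by simp
  moreover have "\<forall>n. 0 \<le> case_nat \<zeta> z n" using z Suc.prems(3) by (simp split: nat.split)
  ultimately show ?case by (intro exI[of _ "case_nat \<zeta> z"]) simp
qed

lemma section_form_extend:
  assumes "N \<le> N'"
  shows "section_form \<alpha> r t N z = section_form \<alpha> r t N' (\<lambda>n. if n < N + r then z n else 0)"
proof -
  have "(\<Sum>n<N + r. f n * (z n)\<^sup>2) = (\<Sum>n<N' + r. f n * (if n < N + r then z n else 0)\<^sup>2)" for f
    using assms by (intro sum.mono_neutral_cong_left) auto
  moreover have "(\<Sum>n<N. f n * z n * z (n + r)) = (\<Sum>n<N'. f n * (if n < N + r then z n else 0)
      * (if n + r < N + r then z (n + r) else 0))" for f
    using assms by (intro sum.mono_neutral_cong_left) auto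
  ultimately show ?thesis unfolding section_form_def by presburger
qed

section \<open>Squared weights of the Stampfli completion\<close>

text \<open>The squared weights in the coordinates \<open>h\<close> and \<open>c = k / h\<close>. The slope \<open>c\<close> is constant along rays
  from the origin, and for fixed \<open>c\<close> the right-hand side is increasing in \<open>h\<close>.\<close>

fun sq_weight :: "real \<Rightarrow> real \<Rightarrow> nat \<Rightarrow> real" where
  "sq_weight h c 0 = 1"
| "sq_weight h c (Suc 0) = 1"
| "sq_weight h c (Suc (Suc n)) = (1 + h) * (1 + c * (1 - 1 / sq_weight h c (Suc n)))"

lemma sq_weight_2: "sq_weight h c 2 = 1 + h" and sq_weight_3: "h > 0 \<Longrightarrow> sq_weight h c 3 = 1 + h * (1 + c)"
  by (simp_all add: eval_nat_numeral field_simps)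

lemma sq_weight_ge_1:
  assumes "0 \<le> h" "0 \<le> c" shows "1 \<le> sq_weight h c n"
proof -
  have "1 \<le> sq_weight h c (Suc n)" for n
  proof (induction n)
    case (Suc n)
    have "1 * 1 \<le> (1 + h) * (1 + c * (1 - 1 / sq_weight h c (Suc n)))"
      using assms Suc by (intro mult_mono) auto
    then show ?case by simp
  qed simp
  then show ?thesis by (cases n) auto
qed

lemma Psi_step:
  assumes "0 < h" "0 < k" "0 < b"
  shows "Psi1 1 (sqrt (1 + h)) (sqrt (1 + h + k)) + Psi0 1 (sqrt (1 + h)) (sqrt (1 + h + k)) / b
    = (1 + h) * (1 + k / h * (1 - 1 / b))"
  using assms by (simp add: Psi0_def Psi1_def field_simps)

lemma weights_eq_sqrt_sq_weight:
  assumes "0 < h" "0 < k"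
  shows "weights (1 + h) (1 + h + k) n = sqrt (sq_weight h (k / h) n)"
proof -
  have s: "stampfli_completion 1 (sqrt (1 + h)) (sqrt (1 + h + k)) m = sqrt (sq_weight h (k / h) (Suc m))" for m
  proof (induction m rule: stampfli_completion.induct[of
      "\<lambda>_ _ _ m. stampfli_completion 1 (sqrt (1 + h)) (sqrt (1 + h + k)) m = sqrt (sq_weight h (k / h) (Suc m))" 1 1 1])
    case (4 a0 a1 a2 n)
    let ?b = "sq_weight h (k / h) (Suc (Suc (Suc n)))"
    have b: "1 \<le> ?b" using assms by (intro sq_weight_ge_1) auto
    have "(sqrt ?b)\<^sup>2 = ?b" using b by simp
    then have "stampfli_completion 1 (sqrt (1 + h)) (sqrt (1 + h + k)) (Suc (Suc (Suc n)))
        = sqrt ((1 + h) * (1 + k / h * (1 - 1 / ?b)))"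
      using Psi_step[OF assms, of ?b] b 4 by (simp)
    then show ?case by (simp only: sq_weight.simps(3)[of h "k / h" "Suc (Suc n)"])
  qed (use assms in \<open>simp_all add: field_simps\<close>)
  show ?thesis by (cases n) (simp_all add: weights_def s)
qed

declare sq_weight.simps(3) [simp del]

definition compl_weight :: "real \<Rightarrow> real \<Rightarrow> nat \<Rightarrow> real" where
  "compl_weight h c n = sqrt (sq_weight h c n)"

text \<open>The following identities concern consecutive terms of a sequence with
  \<open>x\<^sub>i\<^sub>+\<^sub>1 * x\<^sub>i = P * x\<^sub>i - d\<close>: products of two or three consecutive terms are affine functions of
  the first one, so differences of such products are multiples of differences of single terms.\<close>

lemma triple_product:
  fixes P d x0 x1 x2 :: real
  assumes "x1 * x0 = P * x0 - d" "x2 * x1 = P * x1 - d"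
  shows "x0 * x1 * x2 = (P\<^sup>2 - d) * x0 - P * d"
proof -
  have "x0 * x1 * x2 = x0 * (P * x1 - d)" using assms(2) by (simp add: mult_ac)
  also have "\<dots> = P * (x1 * x0) - d * x0" by (simp add: algebra_simps)
  finally show ?thesis unfolding assms(1) by (simp add: algebra_simps power2_eq_square)
qed

text \<open>This and the next lemma are the reason why the commutator is a sum of squares from index \<open>2\<close> on:
  the squared off-diagonal entry is the product of two diagonal gaps.\<close>

lemma chain_identity_1:
  fixes P d x0 x1 x2 x3 :: real
  assumes "x1 * x0 = P * x0 - d" "x2 * x1 = P * x1 - d" "x3 * x2 = P * x2 - d"
  shows "(x2 - x0)\<^sup>2 * x1 = (x1 - x0) * (x2 * x3 - x0 * x1)"
proof -
  have "(x2 - x0)\<^sup>2 * x1 = (x2 - x0) * (x2 * x1 - x1 * x0)"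
    by (simp add: algebra_simps power2_eq_square)
  also have "\<dots> = (x1 - x0) * (x3 * x2 - x1 * x0)"
    unfolding assms by (simp add: algebra_simps)
  finally show ?thesis by (simp add: mult_ac)
qed

lemma chain_identity_2:
  fixes P d x0 x1 x2 x3 x4 x5 :: real
  assumes "x1 * x0 = P * x0 - d" "x2 * x1 = P * x1 - d" "x3 * x2 = P * x2 - d"
    "x4 * x3 = P * x3 - d" "x5 * x4 = P * x4 - d"
  shows "(x3 - x0)\<^sup>2 * (x1 * x2) = (x1 - x0) * (x3 * x4 * x5 - x0 * x1 * x2)"
proof -
  have "(x3 - x0)\<^sup>2 * (x1 * x2) = (x3 - x0) * (x1 * x2 * x3 - x0 * x1 * x2)"
    by (simp add: algebra_simps power2_eq_square)
  also have "\<dots> = (x1 - x0) * (x3 * x4 * x5 - x0 * x1 * x2)"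
    unfolding triple_product[OF assms(1,2)] triple_product[OF assms(2,3)] triple_product[OF assms(4,5)]
    by (simp add: algebra_simps)
  finally show ?thesis .
qed

lemma gap_recursion:
  fixes P d x0 x1 x2 :: real
  assumes "x1 * x0 = P * x0 - d" "x2 * x1 = P * x1 - d"
  shows "x0 * x1 * (x2 - x1) = d * (x1 - x0)"
proof -
  have "x0 * x1 * (x2 - x1) = x0 * (x2 * x1) - x1 * (x1 * x0)" by (simp add: algebra_simps)
  then show ?thesis unfolding assms by (simp add: algebra_simps)
qed

text \<open>The ratio of the two diagonal gaps at the same index, which is what enters the sums
  \<^const>\<open>ratio_sum\<close>, is a constant multiple of an earlier term; in the cubic case it is a constant
  multiple of the product of two earlier terms.\<close>

lemma ratio_1:
  fixes P d x0 x1 x2 x3 :: real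
  assumes "x1 * x0 = P * x0 - d" "x2 * x1 = P * x1 - d" "x3 * x2 = P * x2 - d" "x1 \<noteq> 0"
  shows "d * (x2 * x3 - x0 * x1) = P\<^sup>2 * x0 * (x2 - x1)"
proof -
  have "x1 * (x2 - x0) = P * (x1 - x0)" using assms(1,2) by (simp add: algebra_simps)
  have "x1 * (d * (x3 * x2 - x1 * x0)) = d * P * (x1 * (x2 - x0))"
    unfolding assms by (simp add: algebra_simps)
  also have "\<dots> = P\<^sup>2 * (d * (x1 - x0))"
    unfolding \<open>x1 * (x2 - x0) = P * (x1 - x0)\<close> by (simp add: power2_eq_square)
  also have "\<dots> = x1 * (P\<^sup>2 * x0 * (x2 - x1))"
    unfolding gap_recursion[OF assms(1,2), symmetric] by (simp add: mult_ac)
  finally show ?thesis using assms(4) by (simp add: mult_ac)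
qed

lemma ratio_2:
  fixes P d x0 x1 x2 x3 x4 x5 :: real
  assumes "x1 * x0 = P * x0 - d" "x2 * x1 = P * x1 - d" "x3 * x2 = P * x2 - d"
    "x4 * x3 = P * x3 - d" "x5 * x4 = P * x4 - d" "x1 * x2 \<noteq> 0"
  shows "d\<^sup>2 * (x3 * x4 * x5 - x0 * x1 * x2) = (P\<^sup>2 - d)\<^sup>2 * (x0 * x1) * (x3 - x2)"
proof -
  have e: "x1 * x2 * (x3 - x0) = (P\<^sup>2 - d) * (x1 - x0)"
    using triple_product[OF assms(1,2)] triple_product[OF assms(2,3)] by (simp add: algebra_simps)
  have "x1 * x2 * (d\<^sup>2 * (x3 * x4 * x5 - x0 * x1 * x2)) = d\<^sup>2 * (P\<^sup>2 - d) * (x1 * x2 * (x3 - x0))"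
    unfolding triple_product[OF assms(1,2)] triple_product[OF assms(4,5)] by (simp add: algebra_simps)
  also have "\<dots> = (P\<^sup>2 - d)\<^sup>2 * d * (d * (x1 - x0))"
    unfolding e by (simp add: power2_eq_square)
  also have "\<dots> = (P\<^sup>2 - d)\<^sup>2 * (x0 * x1) * (d * (x2 - x1))"
    unfolding gap_recursion[OF assms(1,2), symmetric] by (simp add: mult_ac)
  also have "\<dots> = x1 * x2 * ((P\<^sup>2 - d)\<^sup>2 * (x0 * x1) * (x3 - x2))"
    unfolding gap_recursion[OF assms(2,3), symmetric] by (simp add: mult_ac)
  finally show ?thesis using assms(6) by (simp add: mult_ac)
qed

lemma ratio_eq:
  fixes d u v p x :: real
  assumes "0 < d" "0 < u" "d * v = p * x * u"
  shows "v / u = p / d * x"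
  using assms by (simp add: field_simps)

context
  fixes h c :: real
  assumes h: "0 < h" and c: "0 < c"
begin

lemma P_square: "((1 + h) * (1 + c))\<^sup>2 = (1 + h) * ((1 + c)\<^sup>2 / c) * ((1 + h) * c)"
  using c by (simp add: power2_eq_square)

lemma P_neq: "(1 + h) * c \<noteq> 0" using h c by simp

lemma sq_weight_pos: "0 < sq_weight h c n"
  using sq_weight_ge_1[of h c n] h c by linarith

text \<open>The recursion with denominators cleared: \<open>P = (1 + h) * (1 + c)\<close> and \<open>d = (1 + h) * c\<close> in the
  identities above.\<close>

lemma sq_weight_mult: "sq_weight h c (Suc (Suc n)) * sq_weight h c (Suc n) = (1 + h) * (1 + c) * sq_weight h c (Suc n) - (1 + h) * c"
  using sq_weight_pos[of "Suc n"] by (simp add: sq_weight.simps(3) field_simps)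

lemma sq_weight_mult_succ:
  assumes "1 \<le> i" "j = Suc i"
  shows "sq_weight h c j * sq_weight h c i = (1 + h) * (1 + c) * sq_weight h c i - (1 + h) * c"
  using sq_weight_mult[of "i - 1"] assms by (simp)

lemma sq_weight_increasing: "sq_weight h c (Suc n) < sq_weight h c (Suc (Suc n))"
proof (induction n)
  case 0
  show ?case using h by (simp add: sq_weight.simps(3))
next
  case (Suc n)
  have "sq_weight h c (Suc n) * sq_weight h c (Suc (Suc n)) * (sq_weight h c (Suc (Suc (Suc n))) - sq_weight h c (Suc (Suc n)))
      = (1 + h) * c * (sq_weight h c (Suc (Suc n)) - sq_weight h c (Suc n))"
    by (rule gap_recursion[OF sq_weight_mult sq_weight_mult])
  also have "\<dots> > 0" using h c Suc by simp
  finally have "0 < sq_weight h c (Suc (Suc (Suc n))) - sq_weight h c (Suc (Suc n))"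
    by (rule zero_less_mult_pos) (intro mult_pos_pos sq_weight_pos)
  then show ?case by simp
qed

lemma sq_weight_mono: "m \<le> n \<Longrightarrow> sq_weight h c m \<le> sq_weight h c n"
proof (rule lift_Suc_mono_le)
  show "sq_weight h c n \<le> sq_weight h c (Suc n)" for n
  proof (cases n)
    case (Suc m)
    then show ?thesis using sq_weight_increasing[of m] by simp
  qed simp
qed

lemma sq_weight_strict_mono: "1 \<le> m \<Longrightarrow> m < n \<Longrightarrow> sq_weight h c m < sq_weight h c n"
  using sq_weight_increasing[of "m - 1"] sq_weight_mono[of "Suc m" n] by simp

lemma sq_weight_le: "sq_weight h c n \<le> (1 + h) * (1 + c)"
proof (induction n rule: nat_less_induct)
  case (1 n)
  have "1 \<le> (1 + h) * (1 + c)" using h c by (simp add: algebra_simps)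
  consider "n = 0" | "n = 1" | m where "n = Suc (Suc m)" by (metis One_nat_def not0_implies_Suc)
  then show ?case
  proof cases
    case 3
    then show ?thesis using h c sq_weight_pos[of "Suc m"] by (simp add: sq_weight.simps(3))
  qed (use \<open>1 \<le> (1 + h) * (1 + c)\<close> in simp_all)
qed

lemma compl_weight_bounded: "\<forall>n. \<bar>compl_weight h c n\<bar> \<le> sqrt ((1 + h) * (1 + c))"
  using sq_weight_le sq_weight_pos by (simp add: compl_weight_def less_imp_le)

lemma shift_power_weight_compl_weight: "shift_power_weight (compl_weight h c) m n = sqrt (\<Prod>j<m. sq_weight h c (n + j))"
  by (induction m) (simp_all add: shift_power_weight_def compl_weight_def real_sqrt_mult)

lemma shift_power_weight_compl_weight_sq: "(shift_power_weight (compl_weight h c) m n)\<^sup>2 = (\<Prod>j<m. sq_weight h c (n + j))"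
  unfolding shift_power_weight_compl_weight using sq_weight_pos by (simp add: prod_nonneg less_imp_le)

lemma diag_gap_compl_weight:
  "diag_gap (compl_weight h c) m n = (\<Prod>j<m. sq_weight h c (n + j)) - (if n < m then 0 else \<Prod>j<m. sq_weight h c (n - m + j))"
  by (simp add: diag_gap_def shift_power_weight_compl_weight_sq)

lemma diag_gap_compl_weight_nonneg: "0 \<le> diag_gap (compl_weight h c) m n"
proof -
  have "(\<Prod>j<m. sq_weight h c (n - m + j)) \<le> (\<Prod>j<m. sq_weight h c (n + j))"
    by (rule prod_mono) (use sq_weight_pos sq_weight_mono in \<open>simp add: less_imp_le del: sq_weight.simps\<close>)
  moreover have "0 \<le> (\<Prod>j<m. sq_weight h c (n + j))"
    using sq_weight_pos by (simp add: prod_nonneg less_imp_le)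
  ultimately show ?thesis unfolding diag_gap_compl_weight diff_ge_0_iff_ge by (simp only: split: if_split) simp
qed

lemma cross_gap_compl_weight:
  "cross_gap (compl_weight h c) r n = (sq_weight h c (n + r) - (if n = 0 then 0 else sq_weight h c (n - 1))) * sqrt (\<Prod>j<r. sq_weight h c (n + j))"
  using sq_weight_pos by (simp add: cross_gap_def shift_power_weight_compl_weight compl_weight_def less_imp_le)

lemma cross_gap_compl_weight_nonneg: "0 \<le> cross_gap (compl_weight h c) r n"
proof -
  have "0 \<le> (\<Prod>j<r. sq_weight h c (n + j))" using sq_weight_pos by (simp add: prod_nonneg less_imp_le)
  moreover have "sq_weight h c (n - 1) \<le> sq_weight h c (n + r)" by (rule sq_weight_mono) simp
  ultimately show ?thesis
    using sq_weight_pos[of "n + r"] by (auto simp: cross_gap_compl_weight intro!: mult_nonneg_nonneg)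
qed

lemma diag_gap_compl_weight_pos:
  assumes "2 \<le> n" shows "0 < diag_gap (compl_weight h c) (Suc m) n"
proof -
  have prod: "0 < (\<Prod>j<k. sq_weight h c (i + j))" for i k
    using sq_weight_pos by (intro prod_pos) auto
  show ?thesis
  proof (cases "n < Suc m")
    case True
    then show ?thesis using prod[of n "Suc m"] by (simp add: diag_gap_compl_weight del: prod.lessThan_Suc)
  next
    case False
    have "(\<Prod>j<m. sq_weight h c (n - Suc m + j)) \<le> (\<Prod>j<m. sq_weight h c (n + j))"
      by (rule prod_mono) (use sq_weight_pos sq_weight_mono in \<open>simp add: less_imp_le del: sq_weight.simps\<close>)
    moreover have "sq_weight h c (n - Suc m + m) < sq_weight h c (n + m)"
      using assms False by (intro sq_weight_strict_mono) auto
    ultimately have "(\<Prod>j<m. sq_weight h c (n - Suc m + j)) * sq_weight h c (n - Suc m + m)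
        < (\<Prod>j<m. sq_weight h c (n + j)) * sq_weight h c (n + m)"
      using prod sq_weight_pos by (intro mult_le_less_imp_less) (auto simp: less_imp_le)
    then show ?thesis using False by (simp add: diag_gap_compl_weight)
  qed
qed

lemma cross_gap_compl_weight_1: 
  "cross_gap (compl_weight h c) 1 (Suc (Suc m)) = sqrt (diag_gap (compl_weight h c) 1 (Suc (Suc m)) * diag_gap (compl_weight h c) 2 (Suc (Suc (Suc m))))"
proof -
  let ?b = "\<lambda>i. sq_weight h c (m + i)"
  have m: "?b j * ?b i = (1 + h) * (1 + c) * ?b i - (1 + h) * c" if "1 \<le> i" "j = Suc i" for i j
    using that by (intro sq_weight_mult_succ) auto
  have "cross_gap (compl_weight h c) 1 (Suc (Suc m)) = sqrt ((?b 3 - ?b 1)\<^sup>2 * ?b 2)"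
    using sq_weight_mono[of "m + 1" "m + 3"]
    by (simp add: cross_gap_compl_weight real_sqrt_mult eval_nat_numeral)
  also have "(?b 3 - ?b 1)\<^sup>2 * ?b 2 = (?b 2 - ?b 1) * (?b 3 * ?b 4 - ?b 1 * ?b 2)"
    by (rule chain_identity_1; rule m; simp)
  finally show ?thesis by (simp add: diag_gap_compl_weight eval_nat_numeral)
qed

lemma cross_gap_compl_weight_2: 
  "cross_gap (compl_weight h c) 2 (Suc (Suc m)) = sqrt (diag_gap (compl_weight h c) 1 (Suc (Suc m)) * diag_gap (compl_weight h c) 3 (Suc (Suc (Suc (Suc m)))))"
proof -
  let ?b = "\<lambda>i. sq_weight h c (m + i)"
  have m: "?b j * ?b i = (1 + h) * (1 + c) * ?b i - (1 + h) * c" if "1 \<le> i" "j = Suc i" for i j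
    using that by (intro sq_weight_mult_succ) auto
  have "cross_gap (compl_weight h c) 2 (Suc (Suc m)) = sqrt ((?b 4 - ?b 1)\<^sup>2 * (?b 2 * ?b 3))"
    using sq_weight_mono[of "m + 1" "m + 4"]
    by (simp add: cross_gap_compl_weight real_sqrt_mult eval_nat_numeral)
  also have "(?b 4 - ?b 1)\<^sup>2 * (?b 2 * ?b 3) = (?b 2 - ?b 1) * (?b 4 * ?b 5 * ?b 6 - ?b 1 * ?b 2 * ?b 3)"
    by (rule chain_identity_2; rule m; simp)
  finally show ?thesis by (simp add: diag_gap_compl_weight eval_nat_numeral)
qed

lemma gap_ratio_1:
  "diag_gap (compl_weight h c) 2 (Suc (Suc (Suc m))) / diag_gap (compl_weight h c) 1 (Suc (Suc (Suc m)))
    = (1 + h) * ((1 + c)\<^sup>2 / c) * sq_weight h c (Suc m)"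
proof -
  let ?b = "\<lambda>i. sq_weight h c (m + i)"
  have m: "?b j * ?b i = (1 + h) * (1 + c) * ?b i - (1 + h) * c" if "1 \<le> i" "j = Suc i" for i j
    using that by (intro sq_weight_mult_succ) auto
  have "(1 + h) * c * (?b 3 * ?b 4 - ?b 1 * ?b 2) = ((1 + h) * (1 + c))\<^sup>2 * ?b 1 * (?b 3 - ?b 2)"
    using sq_weight_pos[of "m + 2"] by (intro ratio_1 m) auto
  moreover have v: "diag_gap (compl_weight h c) 2 (Suc (Suc (Suc m))) = ?b 3 * ?b 4 - ?b 1 * ?b 2"
    by (simp add: diag_gap_compl_weight eval_nat_numeral)
  moreover have u: "diag_gap (compl_weight h c) 1 (Suc (Suc (Suc m))) = ?b 3 - ?b 2"
    by (simp add: diag_gap_compl_weight eval_nat_numeral)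
  moreover have "0 < ?b 3 - ?b 2" using sq_weight_strict_mono[of "m + 2" "m + 3"] by simp
  moreover have "0 < (1 + h) * c" using h c by simp
  ultimately have "diag_gap (compl_weight h c) 2 (Suc (Suc (Suc m))) / diag_gap (compl_weight h c) 1 (Suc (Suc (Suc m)))
      = ((1 + h) * (1 + c))\<^sup>2 / ((1 + h) * c) * ?b 1"
    by (simp only: ratio_eq)
  also have "((1 + h) * (1 + c))\<^sup>2 / ((1 + h) * c) = (1 + h) * ((1 + c)\<^sup>2 / c)"
    unfolding P_square by (rule nonzero_mult_div_cancel_right[OF P_neq])
  finally show ?thesis by simp
qed

lemma gap_ratio_2:
  "diag_gap (compl_weight h c) 3 (5 + m) / diag_gap (compl_weight h c) 1 (5 + m)
    = ((1 + h) * ((1 + c)\<^sup>2 / c) - 1)\<^sup>2 * (sq_weight h c (2 + m) * sq_weight h c (3 + m))"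
proof -
  let ?b = "\<lambda>i. sq_weight h c (m + i)"
  have m: "?b j * ?b i = (1 + h) * (1 + c) * ?b i - (1 + h) * c" if "1 \<le> i" "j = Suc i" for i j
    using that by (intro sq_weight_mult_succ) auto
  have "((1 + h) * c)\<^sup>2 * (?b 5 * ?b 6 * ?b 7 - ?b 2 * ?b 3 * ?b 4)
      = (((1 + h) * (1 + c))\<^sup>2 - (1 + h) * c)\<^sup>2 * (?b 2 * ?b 3) * (?b 5 - ?b 4)"
    using sq_weight_pos[of "m + 3"] sq_weight_pos[of "m + 4"] by (intro ratio_2 m) auto
  moreover have "diag_gap (compl_weight h c) 3 (5 + m) = ?b 5 * ?b 6 * ?b 7 - ?b 2 * ?b 3 * ?b 4"
    by (simp add: diag_gap_compl_weight eval_nat_numeral)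
  moreover have "diag_gap (compl_weight h c) 1 (5 + m) = ?b 5 - ?b 4"
    by (simp add: diag_gap_compl_weight eval_nat_numeral)
  moreover have "0 < ?b 5 - ?b 4" using sq_weight_strict_mono[of "m + 4" "m + 5"] by simp
  moreover have "0 < ((1 + h) * c)\<^sup>2" using h c by simp
  ultimately have "diag_gap (compl_weight h c) 3 (5 + m) / diag_gap (compl_weight h c) 1 (5 + m)
      = (((1 + h) * (1 + c))\<^sup>2 - (1 + h) * c)\<^sup>2 / ((1 + h) * c)\<^sup>2 * (?b 2 * ?b 3)"
    by (simp only: ratio_eq)
  also have "(((1 + h) * (1 + c))\<^sup>2 - (1 + h) * c)\<^sup>2 / ((1 + h) * c)\<^sup>2
      = ((((1 + h) * (1 + c))\<^sup>2 - (1 + h) * c) / ((1 + h) * c))\<^sup>2"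
    by (simp only: power_divide)
  also have "(((1 + h) * (1 + c))\<^sup>2 - (1 + h) * c) / ((1 + h) * c) = (1 + h) * ((1 + c)\<^sup>2 / c) - 1"
    unfolding P_square diff_divide_distrib nonzero_mult_div_cancel_right[OF P_neq] divide_self[OF P_neq] ..
  finally show ?thesis by (simp add: add.commute)
qed

end

section \<open>Scalar criteria for hyponormality\<close>

text \<open>Here \<open>\<tau> = t * (1 + h)\<close>. In this scaling no term on the right decreases when \<open>h\<close> does, for fixed
  \<open>c\<close>; in terms of \<open>t\<close> the linear term \<open>t * (1 + h) * (1 + c)\<close> would.\<close>

definition quadratic_criterion :: "real \<Rightarrow> real \<Rightarrow> bool" where
  "quadratic_criterion h c \<longleftrightarrow> (\<forall>\<tau>>0. \<forall>N.
     1 \<le> (1 + c) * \<tau> + \<tau> / (1 + h) * (1 + 1 / (h + \<tau>))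
       + 1 / ratio_sum (\<lambda>i. (1 + c)\<^sup>2 / c * sq_weight h c (Suc i)) \<tau> N)"

definition cubic_slope :: "real \<Rightarrow> real \<Rightarrow> real" where
  "cubic_slope h c = (let p = 1 + c + c\<^sup>2 + h * (1 + c)\<^sup>2 in (1 + c) * c * (p + 1) / ((1 + h) * p\<^sup>2))"

text \<open>Here \<open>\<tau> = t * (p / c)\<^sup>2 * (1 + h)\<^sup>2\<close> with the \<open>p\<close> of \<^const>\<open>cubic_slope\<close>; when
  \<open>h\<close> decreases, the left side decreases and no term on the right does.\<close>

definition cubic_criterion :: "real \<Rightarrow> real \<Rightarrow> bool" where
  "cubic_criterion h c \<longleftrightarrow> (\<forall>\<tau>>0. \<forall>N.
     h * ((1 + c)\<^sup>2 / c) / (1 + h * (1 + c)) \<le> cubic_slope h c * \<tau>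
       + 1 / ratio_sum (\<lambda>i. (sq_weight h c (2 * i + 2) / (1 + h)) * (sq_weight h c (2 * i + 3) / (1 + h))) \<tau> N)"

lemma three_term_minimum:
  fixes d0 d1 e w0 w1 x y z :: real
  assumes "0 < d0" "d1 - w0\<^sup>2 / d0 = e" "0 < e"
  shows "d0 * x\<^sup>2 + d1 * y\<^sup>2 - 2 * w0 * x * y - 2 * w1 * y * z
    = d0 * (x - w0 / d0 * y)\<^sup>2 + e * (y - w1 / e * z)\<^sup>2 - w1\<^sup>2 / e * z\<^sup>2"
proof -
  have "d0 * x\<^sup>2 - 2 * w0 * x * y = d0 * (x - w0 / d0 * y)\<^sup>2 - w0\<^sup>2 / d0 * y\<^sup>2"
    using assms(1) by (simp add: field_simps power2_eq_square)
  moreover have "e * y\<^sup>2 - 2 * w1 * y * z = e * (y - w1 / e * z)\<^sup>2 - w1\<^sup>2 / e * z\<^sup>2"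
    using assms(3) by (simp add: field_simps power2_eq_square)
  moreover have "d1 * y\<^sup>2 = e * y\<^sup>2 + w0\<^sup>2 / d0 * y\<^sup>2"
    unfolding assms(2)[symmetric] by (simp add: left_diff_distrib)
  ultimately show ?thesis by linarith
qed

context
  fixes h c :: real
  assumes h: "0 < h" and c: "0 < c"
begin

abbreviation (input) "gap \<equiv> diag_gap (compl_weight h c)"

lemma gap_pos: "2 \<le> n \<Longrightarrow> 0 < gap 1 n" "2 \<le> n \<Longrightarrow> 0 < gap 2 n" "2 \<le> n \<Longrightarrow> 0 < gap 3 n"
  using diag_gap_compl_weight_pos[OF h c, of n 0] diag_gap_compl_weight_pos[OF h c, of n 1] diag_gap_compl_weight_pos[OF h c, of n 2]
  by (simp_all add: numeral_2_eq_2 numeral_3_eq_3)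

lemma gap_1_2: "gap 1 2 = h" and gap_1_3: "gap 1 3 = c * h"
  using sq_weight_3[OF h, of c] by (simp_all add: diag_gap_compl_weight[OF h c] eval_nat_numeral sq_weight.simps(3) algebra_simps)

text \<open>The equal weights at indices \<open>0\<close> and \<open>1\<close> break the chain structure, so these two variables form a
  separate head.\<close>

lemma quadratic_section_split:
  "section_form (compl_weight h c) 1 t (Suc (Suc N)) z =
     ((1 + t) * (z 0)\<^sup>2 + t * (1 + h) * (z 1)\<^sup>2 - 2 * sqrt t * z 0 * z 1 - 2 * (sqrt t * h) * z 1 * z 2)
     + (t * gap 2 2 * (z 2)\<^sup>2 + chain_form (\<lambda>n. gap 1 (2 + n)) (\<lambda>n. gap 2 (2 + n)) t N (\<lambda>n. z (2 + n)))"
proof -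
  have vals: "gap 1 0 = 1" "gap 1 (Suc 0) = 0" "gap 2 0 = 1" "gap 2 (Suc 0) = 1 + h"
    "cross_gap (compl_weight h c) 1 0 = 1" "cross_gap (compl_weight h c) 1 (Suc 0) = h"
    by (simp_all add: diag_gap_compl_weight[OF h c] cross_gap_compl_weight[OF h c] eval_nat_numeral sq_weight.simps(3))
  have tail: "t * gap 2 2 * (z 2)\<^sup>2 + chain_form (\<lambda>n. gap 1 (2 + n)) (\<lambda>n. gap 2 (2 + n)) t N (\<lambda>n. z (2 + n))
      = (\<Sum>n<Suc N. (gap 1 (Suc (Suc n)) + t * gap 2 (Suc (Suc n))) * (z (Suc (Suc n)))\<^sup>2)
        - 2 * sqrt t * (\<Sum>n<N. cross_gap (compl_weight h c) 1 (Suc (Suc n)) * z (Suc (Suc n)) * z (Suc (Suc (Suc n))))"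
    using chain_form_eq_sum[of t "\<lambda>n. gap 2 (2 + n)" "\<lambda>n. z (2 + n)" "\<lambda>n. gap 1 (2 + n)" N]
    unfolding cross_gap_compl_weight_1[OF h c] by (simp del: sum.lessThan_Suc)
  have "section_form (compl_weight h c) 1 t (Suc (Suc N)) z =
     (gap 1 0 + t * gap 2 0) * (z 0)\<^sup>2 + (gap 1 (Suc 0) + t * gap 2 (Suc 0)) * (z (Suc 0))\<^sup>2
     + (\<Sum>n<Suc N. (gap 1 (Suc (Suc n)) + t * gap 2 (Suc (Suc n))) * (z (Suc (Suc n)))\<^sup>2)
     - 2 * sqrt t * (cross_gap (compl_weight h c) 1 0 * z 0 * z (Suc 0) + cross_gap (compl_weight h c) 1 (Suc 0) * z (Suc 0) * z (Suc (Suc 0))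
     + (\<Sum>n<N. cross_gap (compl_weight h c) 1 (Suc (Suc n)) * z (Suc (Suc n)) * z (Suc (Suc (Suc n)))))"
    unfolding section_form_def Suc_1[symmetric]
    by (simp add: sum.lessThan_Suc_shift del: sum.lessThan_Suc)
  then show ?thesis unfolding tail vals by (simp add: algebra_simps numeral_2_eq_2 del: sum.lessThan_Suc)
qed

text \<open>Minimising the head over its two variables leaves a negative multiple of \<open>(z 2)\<^sup>2\<close>, which the
  Schur complement of the chain has to outweigh.\<close>

lemma quadratic_sections_iff:
  assumes t: "0 < t"
  shows "(\<forall>N z. (\<forall>n. 0 \<le> z n) \<longrightarrow> 0 \<le> section_form (compl_weight h c) 1 t N z) \<longleftrightarrow>
    (\<forall>N. t * h\<^sup>2 * (1 + t) / (t * (h + t * (1 + h)))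
       \<le> t * gap 2 2 + h / chain_ratio_sum (\<lambda>n. gap 1 (2 + n)) (\<lambda>n. gap 2 (2 + n)) t N)"
proof -
  let ?e = "t * (h + t * (1 + h)) / (1 + t)" and ?A = "\<lambda>n. gap 1 (2 + n)" and ?B = "\<lambda>n. gap 2 (2 + n)"
  let ?K = "t * h\<^sup>2 * (1 + t) / (t * (h + t * (1 + h)))"
  have e: "0 < ?e" using t h by (simp add: add_pos_pos)
  have K: "(sqrt t * h)\<^sup>2 / ?e = ?K" using t by (simp add: power_mult_distrib)
  have AB: "0 < ?A n" "0 < ?B n" for n using gap_pos by auto
  have A0: "?A 0 = h" using gap_1_2 by simp
  have e_eq: "t * (1 + h) - (sqrt t)\<^sup>2 / (1 + t) = ?e" using t by (simp add: field_simps)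
  have head: "(1 + t) * x\<^sup>2 + t * (1 + h) * y\<^sup>2 - 2 * sqrt t * x * y - 2 * (sqrt t * h) * y * z
    = (1 + t) * (x - sqrt t / (1 + t) * y)\<^sup>2 + ?e * (y - sqrt t * h / ?e * z)\<^sup>2 - ?K * z\<^sup>2" for x y z
    unfolding K[symmetric] by (rule three_term_minimum[OF _ e_eq e]) (use t in simp)
  show ?thesis
  proof (intro iffI allI impI)
    fix N
    assume pos: "\<forall>N z. (\<forall>n. 0 \<le> z n) \<longrightarrow> 0 \<le> section_form (compl_weight h c) 1 t N z"
    obtain z where z: "z 0 = 1" "\<forall>n. 0 \<le> z n"
      "chain_form ?A ?B t N z = ?A 0 / chain_ratio_sum ?A ?B t N * 1\<^sup>2"
      using chain_form_attained[of t ?A ?B 1 N] t AB by auto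
    \<comment> \<open>With these two values both squares in \<open>head\<close> vanish.\<close>
    define y where "y = sqrt t * h / ?e"
    define x where "x = sqrt t / (1 + t) * y"
    have y0: "0 \<le> y" using t h e by (simp add: y_def less_imp_le)
    have x0: "0 \<le> x" using t y0 by (simp add: x_def)
    let ?z = "case_nat x (case_nat y z)"
    have "0 \<le> section_form (compl_weight h c) 1 t (Suc (Suc N)) ?z"
      using pos z(2) x0 y0 by (auto split: nat.split)
    also have "\<dots> = (1 + t) * x\<^sup>2 + t * (1 + h) * y\<^sup>2 - 2 * sqrt t * x * y - 2 * (sqrt t * h) * y * 1
        + (t * gap 2 2 + h / chain_ratio_sum ?A ?B t N)"
      unfolding quadratic_section_split using z A0 by (simp add: numeral_2_eq_2)
    also have "\<dots> = - ?K + (t * gap 2 2 + h / chain_ratio_sum ?A ?B t N)"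
    proof -
      have "x - sqrt t / (1 + t) * y = 0" by (simp add: x_def)
      moreover have "y - sqrt t * h / ?e * 1 = 0" by (simp add: y_def)
      ultimately show ?thesis unfolding head by simp
    qed
    finally show "?K \<le> t * gap 2 2 + h / chain_ratio_sum ?A ?B t N" by simp
  next
    fix N and z :: "nat \<Rightarrow> real"
    assume crit: "\<forall>N. ?K \<le> t * gap 2 2 + h / chain_ratio_sum ?A ?B t N"
    have "0 \<le> section_form (compl_weight h c) 1 t (Suc (Suc N)) z" for N z
    proof -
      have "?K * (z 2)\<^sup>2 \<le> (t * gap 2 2 + h / chain_ratio_sum ?A ?B t N) * (z 2)\<^sup>2"
        using crit by (intro mult_right_mono) auto
      also have "\<dots> \<le> t * gap 2 2 * (z 2)\<^sup>2 + chain_form ?A ?B t N (\<lambda>n. z (2 + n))"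
        using chain_form_ge[of t ?A ?B N "\<lambda>n. z (2 + n)"] t AB A0 by (simp add: distrib_right)
      finally show ?thesis unfolding quadratic_section_split head using t e
        by (smt (verit) mult_nonneg_nonneg zero_le_power2)
    qed
    then show "0 \<le> section_form (compl_weight h c) 1 t N z"
      using section_form_extend[of N "Suc (Suc N)" "compl_weight h c" 1 t z] by simp
  qed
qed

lemma gap_2_2: "gap 2 2 = h * ((1 + h) * (1 + c) + 1)"
  using sq_weight_3[OF h, of c] sq_weight_2[of h c]
  by (simp add: diag_gap_compl_weight[OF h c] eval_nat_numeral algebra_simps)

theorem quadratically_hyponormal_compl_weight_iff:
  "quadratically_hyponormal (weighted_shift (compl_weight h c)) \<longleftrightarrow> quadratic_criterion h c"
proof -
  let ?K = "\<lambda>t. t * h\<^sup>2 * (1 + t) / (t * (h + t * (1 + h)))"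
  let ?S = "chain_ratio_sum (\<lambda>n. gap 1 (2 + n)) (\<lambda>n. gap 2 (2 + n))"
  let ?R = "ratio_sum (\<lambda>i. (1 + c)\<^sup>2 / c * sq_weight h c (Suc i))"
  let ?Q = "\<lambda>\<tau> N. 1 \<le> (1 + c) * \<tau> + \<tau> / (1 + h) * (1 + 1 / (h + \<tau>)) + 1 / ?R \<tau> N"
  have S: "?S t N = ?R (t * (1 + h)) N" for t N
  proof (rule ratio_sum_cong)
    fix i
    have "gap 2 (2 + Suc i) / gap 1 (2 + Suc i) = (1 + h) * ((1 + c)\<^sup>2 / c) * sq_weight h c (Suc i)"
      using gap_ratio_1[OF h c, of i] by (simp add: numeral_2_eq_2)
    then show "t * (gap 2 (2 + Suc i) / gap 1 (2 + Suc i)) = t * (1 + h) * ((1 + c)\<^sup>2 / c * sq_weight h c (Suc i))"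
      by (simp only: mult.assoc)
  qed
  have eq: "?K t \<le> t * gap 2 2 + h / ?S t N \<longleftrightarrow> ?Q (t * (1 + h)) N" if t: "0 < t" for t N
  proof -
    let ?\<tau> = "t * (1 + h)"
    have \<tau>: "0 < h + ?\<tau>" using h t by (simp add: add_pos_pos)
    have "?K t = h * (h * (1 + t) / (h + ?\<tau>))"
      using t by (simp add: power2_eq_square)
    also have "h * (1 + t) / (h + ?\<tau>) = 1 - t / (h + ?\<tau>)"
      using \<tau> by (simp add: field_simps)
    finally have K: "?K t = h * (1 - t / (h + ?\<tau>))" .
    have R: "t * gap 2 2 + h / ?S t N = h * (t * ((1 + h) * (1 + c) + 1) + 1 / ?R ?\<tau> N)"
      unfolding S gap_2_2 by (simp add: algebra_simps)
    have "?\<tau> / (1 + h) = t" using h by simp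
    then have T: "(1 + c) * ?\<tau> + ?\<tau> / (1 + h) * (1 + 1 / (h + ?\<tau>)) + 1 / ?R ?\<tau> N
        = t * ((1 + h) * (1 + c) + 1) + 1 / ?R ?\<tau> N + t / (h + ?\<tau>)"
      by (simp add: algebra_simps)
    show ?thesis unfolding K R T mult_le_cancel_left_pos[OF h] by argo
  qed
  have "quadratically_hyponormal (weighted_shift (compl_weight h c)) \<longleftrightarrow>
    (\<forall>t>0. \<forall>N z. (\<forall>n. 0 \<le> z n) \<longrightarrow> 0 \<le> section_form (compl_weight h c) 1 t N z)"
    by (rule quadratically_hyponormal_iff_sections[OF compl_weight_bounded[OF h c]
          diag_gap_compl_weight_nonneg[OF h c] diag_gap_compl_weight_nonneg[OF h c] cross_gap_compl_weight_nonneg[OF h c]])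
  also have "\<dots> \<longleftrightarrow> (\<forall>t>0. \<forall>N. ?Q (t * (1 + h)) N)"
    using quadratic_sections_iff eq by simp
  also have "\<dots> \<longleftrightarrow> quadratic_criterion h c"
    unfolding quadratic_criterion_def
  proof (intro iffI allI impI)
    fix \<tau> :: real and N assume "\<forall>t>0. \<forall>N. ?Q (t * (1 + h)) N" "0 < \<tau>"
    moreover have "0 < \<tau> / (1 + h)" "\<tau> / (1 + h) * (1 + h) = \<tau>" using \<open>0 < \<tau>\<close> h by auto
    ultimately have "?Q (\<tau> / (1 + h) * (1 + h)) N" by blast
    then show "?Q \<tau> N" unfolding \<open>\<tau> / (1 + h) * (1 + h) = \<tau>\<close> .
  next
    fix t :: real and N assume "\<forall>\<tau>>0. \<forall>N. ?Q \<tau> N" "0 < t"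
    moreover have "0 < t * (1 + h)" using \<open>0 < t\<close> h by simp
    ultimately show "?Q (t * (1 + h)) N" by blast
  qed
  finally show ?thesis .
qed

lemma gap_3_3: "gap 3 3 = h * ((1 + h) * (1 + c) * ((1 + c + c\<^sup>2 + h * (1 + c)\<^sup>2) + 1))"
proof -
  have "sq_weight h c 3 * sq_weight h c 4 * sq_weight h c 5
      = (((1 + h) * (1 + c))\<^sup>2 - (1 + h) * c) * sq_weight h c 3 - (1 + h) * (1 + c) * ((1 + h) * c)"
    by (rule triple_product) (rule sq_weight_mult_succ[OF h c]; simp)+
  moreover have "gap 3 3 = sq_weight h c 3 * sq_weight h c 4 * sq_weight h c 5 - (1 + h)"
    using sq_weight_2[of h c] by (simp add: diag_gap_compl_weight[OF h c] eval_nat_numeral)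
  ultimately show ?thesis
    unfolding sq_weight_3[OF h] by (simp add: algebra_simps power2_eq_square)
qed

text \<open>This lower bound makes the even half of the cubic form nonnegative for all \<open>t\<close>.\<close>

lemma gap_3_2_ge: "(1 + h)\<^sup>2 \<le> gap 3 2"
proof -
  have "1 + h \<le> sq_weight h c 3" using sq_weight_mono[OF h c, of 2 3] by (simp add: sq_weight_2)
  moreover have "1 \<le> sq_weight h c 4" using h c by (intro sq_weight_ge_1) auto
  ultimately have "(1 + h) * ((1 + h) * 1) \<le> (1 + h) * (sq_weight h c 3 * sq_weight h c 4)"
    using h by (intro mult_left_mono mult_mono) auto
  moreover have "gap 3 2 = sq_weight h c 2 * sq_weight h c 3 * sq_weight h c 4"
    by (simp add: diag_gap_compl_weight[OF h c] eval_nat_numeral)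
  ultimately show ?thesis by (simp add: sq_weight_2 power2_eq_square mult.assoc)
qed

text \<open>Steps of length two decouple even and odd indices; each half is a chain with one head variable.\<close>

lemma cubic_section_split:
  "section_form (compl_weight h c) 2 t (2 * Suc M) z =
     ((1 + t * (1 + h)) * (z 0)\<^sup>2 - 2 * (sqrt t * (1 + h)) * z 0 * z 2
       + (t * gap 3 2 * (z 2)\<^sup>2 + chain_form (\<lambda>n. gap 1 (2 + 2 * n)) (\<lambda>n. gap 3 (2 + 2 * n)) t M (\<lambda>n. z (2 + 2 * n))))
     + (t * ((1 + h) * sq_weight h c 3) * (z 1)\<^sup>2 - 2 * (sqrt t * (h * (1 + c) * sqrt (1 + h))) * z 1 * z 3
       + (t * gap 3 3 * (z 3)\<^sup>2 + chain_form (\<lambda>n. gap 1 (3 + 2 * n)) (\<lambda>n. gap 3 (3 + 2 * n)) t M (\<lambda>n. z (3 + 2 * n))))"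
proof -
  let ?d = "\<lambda>n. (gap 1 n + t * gap 3 n) * (z n)\<^sup>2" and ?w = "\<lambda>n. cross_gap (compl_weight h c) 2 n * z n * z (n + 2)"
  have parity: "(\<Sum>n<2 * K. f n) = (\<Sum>i<K. f (2 * i)) + (\<Sum>i<K. f (2 * i + 1))" for f :: "nat \<Rightarrow> real" and K
    by (induction K) (simp_all add: algebra_simps)
  have vals: "gap 1 0 = 1" "gap 1 1 = 0" "gap 3 0 = 1 + h" "gap 3 1 = (1 + h) * sq_weight h c 3"
    "cross_gap (compl_weight h c) 2 0 = 1 + h" "cross_gap (compl_weight h c) 2 1 = h * (1 + c) * sqrt (1 + h)"
    using sq_weight_2[of h c] sq_weight_3[OF h, of c]
    by (simp_all add: diag_gap_compl_weight[OF h c] cross_gap_compl_weight[OF h c] eval_nat_numeral)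
  have tail: "t * gap 3 k * (z k)\<^sup>2 + chain_form (\<lambda>n. gap 1 (k + 2 * n)) (\<lambda>n. gap 3 (k + 2 * n)) t M (\<lambda>n. z (k + 2 * n))
      = (\<Sum>n<Suc M. ?d (k + 2 * n)) - 2 * sqrt t * (\<Sum>n<M. ?w (k + 2 * n))" if "2 \<le> k" for k
  proof -
    have "cross_gap (compl_weight h c) 2 (k + 2 * n) = sqrt (gap 1 (k + 2 * n) * gap 3 (k + 2 * Suc n))" for n
    proof -
      obtain j where "k = Suc (Suc j)" using \<open>2 \<le> k\<close> by (metis add_2_eq_Suc le_Suc_ex)
      then show ?thesis using cross_gap_compl_weight_2[OF h c, of "j + 2 * n"] by simp
    qed
    then show ?thesis
      using chain_form_eq_sum[of t "\<lambda>n. gap 3 (k + 2 * n)" "\<lambda>n. z (k + 2 * n)" "\<lambda>n. gap 1 (k + 2 * n)" M]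
      by (simp add: add.commute add.left_commute del: sum.lessThan_Suc One_nat_def)
  qed
  have "section_form (compl_weight h c) 2 t (2 * Suc M) z
      = (\<Sum>n<2 * Suc (Suc M). ?d n) - 2 * sqrt t * (\<Sum>n<2 * Suc M. ?w n)"
    by (simp add: section_form_def numeral_3_eq_3 numeral_2_eq_2 del: sum.lessThan_Suc)
  also have "\<dots> = (?d 0 + (\<Sum>n<Suc M. ?d (2 + 2 * n))) + (?d 1 + (\<Sum>n<Suc M. ?d (3 + 2 * n)))
      - 2 * sqrt t * ((?w 0 + (\<Sum>n<M. ?w (2 + 2 * n))) + (?w 1 + (\<Sum>n<M. ?w (3 + 2 * n))))"
  proof -
    have shift: "(\<Sum>i<Suc K. f (2 * i)) = f 0 + (\<Sum>i<K. f (2 + 2 * i))"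
      "(\<Sum>i<Suc K. f (2 * i + 1)) = f 1 + (\<Sum>i<K. f (3 + 2 * i))" for f :: "nat \<Rightarrow> real" and K
      by (simp_all add: sum.lessThan_Suc_shift numeral_3_eq_3 del: sum.lessThan_Suc)
    show ?thesis by (simp only: parity[of ?d] parity[of ?w] shift[of ?d] shift[of ?w])
  qed
  also have "\<dots> = (?d 0 - 2 * sqrt t * ?w 0 + ((\<Sum>n<Suc M. ?d (2 + 2 * n)) - 2 * sqrt t * (\<Sum>n<M. ?w (2 + 2 * n))))
      + (?d 1 - 2 * sqrt t * ?w 1 + ((\<Sum>n<Suc M. ?d (3 + 2 * n)) - 2 * sqrt t * (\<Sum>n<M. ?w (3 + 2 * n))))"
    by (simp only: distrib_left)
  also have "(\<Sum>n<Suc M. ?d (2 + 2 * n)) - 2 * sqrt t * (\<Sum>n<M. ?w (2 + 2 * n))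
      = t * gap 3 2 * (z 2)\<^sup>2 + chain_form (\<lambda>n. gap 1 (2 + 2 * n)) (\<lambda>n. gap 3 (2 + 2 * n)) t M (\<lambda>n. z (2 + 2 * n))"
    by (rule tail[symmetric]) simp
  also have "(\<Sum>n<Suc M. ?d (3 + 2 * n)) - 2 * sqrt t * (\<Sum>n<M. ?w (3 + 2 * n))
      = t * gap 3 3 * (z 3)\<^sup>2 + chain_form (\<lambda>n. gap 1 (3 + 2 * n)) (\<lambda>n. gap 3 (3 + 2 * n)) t M (\<lambda>n. z (3 + 2 * n))"
    by (rule tail[symmetric]) simp
  finally show ?thesis unfolding vals by (simp add: numeral_3_eq_3 numeral_2_eq_2 mult.assoc del: sum.lessThan_Suc)
qed

lemma cubic_sections_iff:
  assumes t: "0 < t"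
  shows "(\<forall>N z. (\<forall>n. 0 \<le> z n) \<longrightarrow> 0 \<le> section_form (compl_weight h c) 2 t N z) \<longleftrightarrow>
    (\<forall>N. (h * (1 + c))\<^sup>2 / sq_weight h c 3
       \<le> t * gap 3 3 + c * h / chain_ratio_sum (\<lambda>n. gap 1 (3 + 2 * n)) (\<lambda>n. gap 3 (3 + 2 * n)) t N)"
proof -
  let ?e = "t * ((1 + h) * sq_weight h c 3)" and ?w = "sqrt t * (h * (1 + c) * sqrt (1 + h))"
  let ?A = "\<lambda>n. gap 1 (3 + 2 * n)" and ?B = "\<lambda>n. gap 3 (3 + 2 * n)"
  let ?A' = "\<lambda>n. gap 1 (2 + 2 * n)" and ?B' = "\<lambda>n. gap 3 (2 + 2 * n)"
  let ?K = "(h * (1 + c))\<^sup>2 / sq_weight h c 3"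
  have e: "0 < ?e" using t h sq_weight_pos[OF h c] by simp
  have K: "?w\<^sup>2 / ?e = ?K" using t h by (simp add: power_mult_distrib)
  have AB: "0 < ?A n" "0 < ?B n" "0 < ?A' n" "0 < ?B' n" for n by (rule gap_pos; simp)+
  have A0: "?A 0 = c * h" using gap_1_3 by simp
  have head: "?e * y\<^sup>2 - 2 * ?w * y * z = ?e * (y - ?w / ?e * z)\<^sup>2 - ?K * z\<^sup>2" for y z
    unfolding K[symmetric] using two_term_minimum[OF e, of 0 z ?w y]
    by (simp only: mult_zero_left diff_0 mult_minus_left mult.commute mult.left_commute)
  show ?thesis
  proof (intro iffI allI impI)
    fix M
    assume pos: "\<forall>N z. (\<forall>n. 0 \<le> z n) \<longrightarrow> 0 \<le> section_form (compl_weight h c) 2 t N z"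
    obtain z where z: "z 0 = 1" "\<forall>n. 0 \<le> z n"
      "chain_form ?A ?B t M z = ?A 0 / chain_ratio_sum ?A ?B t M * 1\<^sup>2"
      using chain_form_attained[of t ?A ?B 1 M] t AB by auto
    define y where "y = ?w / ?e"
    have y0: "0 \<le> y" using t h c e by (simp add: y_def less_imp_le)
    \<comment> \<open>The even half is set to zero, and the odd half carries the minimiser.\<close>
    let ?z = "\<lambda>n. if even n then 0 else if n = 1 then y else z ((n - 3) div 2)"
    have ev: "chain_form ?A' ?B' t M (\<lambda>n. ?z (2 + 2 * n)) = 0"
      using chain_form_eq_sum[of t ?B' "\<lambda>n. ?z (2 + 2 * n)" ?A' M] by simp
    have "0 \<le> section_form (compl_weight h c) 2 t (2 * Suc M) ?z"
      using pos z(2) y0 by auto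
    also have "\<dots> = ?e * y\<^sup>2 - 2 * ?w * y * 1 + (t * gap 3 3 + c * h / chain_ratio_sum ?A ?B t M)"
      unfolding cubic_section_split ev using z A0 by simp
    also have "\<dots> = - ?K + (t * gap 3 3 + c * h / chain_ratio_sum ?A ?B t M)"
    proof -
      have "y - ?w / ?e * 1 = 0" by (simp add: y_def)
      then show ?thesis unfolding head by simp
    qed
    finally show "?K \<le> t * gap 3 3 + c * h / chain_ratio_sum ?A ?B t M" by simp
  next
    fix N and z :: "nat \<Rightarrow> real"
    assume crit: "\<forall>N. ?K \<le> t * gap 3 3 + c * h / chain_ratio_sum ?A ?B t N"
    have "0 \<le> section_form (compl_weight h c) 2 t (2 * Suc M) z" for M z
    proof -
      have "?K * (z 3)\<^sup>2 \<le> (t * gap 3 3 + c * h / chain_ratio_sum ?A ?B t M) * (z 3)\<^sup>2"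
        using crit by (intro mult_right_mono) auto
      also have "\<dots> \<le> t * gap 3 3 * (z 3)\<^sup>2 + chain_form ?A ?B t M (\<lambda>n. z (3 + 2 * n))"
        using chain_form_ge[of t ?A ?B M "\<lambda>n. z (3 + 2 * n)"] t AB A0 by (simp add: distrib_right)
      finally have odd: "0 \<le> ?e * (z 1)\<^sup>2 - 2 * ?w * z 1 * z 3
          + (t * gap 3 3 * (z 3)\<^sup>2 + chain_form ?A ?B t M (\<lambda>n. z (3 + 2 * n)))"
        unfolding head using e by (smt (verit) mult_nonneg_nonneg zero_le_power2)
      have chain: "0 \<le> chain_form ?A' ?B' t M (\<lambda>n. z (2 + 2 * n))"
        using t AB by (intro chain_form_nonneg)
      have "t * (1 + h)\<^sup>2 * (z 2)\<^sup>2 \<le> t * gap 3 2 * (z 2)\<^sup>2"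
        using gap_3_2_ge t by (intro mult_right_mono mult_left_mono) auto
      moreover have "(1 + t * (1 + h)) * (z 0)\<^sup>2 - 2 * (sqrt t * (1 + h)) * z 0 * z 2 + t * (1 + h)\<^sup>2 * (z 2)\<^sup>2
          = (z 0 - sqrt t * (1 + h) * z 2)\<^sup>2 + t * (1 + h) * (z 0)\<^sup>2"
      proof -
        have "(sqrt t * (1 + h) * z 2)\<^sup>2 = t * (1 + h)\<^sup>2 * (z 2)\<^sup>2"
          using t by (simp add: power_mult_distrib)
        then show ?thesis unfolding power2_diff by (simp add: algebra_simps)
      qed
      moreover have "0 \<le> (z 0 - sqrt t * (1 + h) * z 2)\<^sup>2 + t * (1 + h) * (z 0)\<^sup>2"
        using t h by simp
      ultimately show ?thesis unfolding cubic_section_split using odd chain by linarith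
    qed
    then show "0 \<le> section_form (compl_weight h c) 2 t N z"
      using section_form_extend[of N "2 * Suc N" "compl_weight h c" 2 t z] by simp
  qed
qed

theorem semi_cubically_hyponormal_compl_weight_iff:
  "semi_cubically_hyponormal (weighted_shift (compl_weight h c)) \<longleftrightarrow> cubic_criterion h c"
proof -
  let ?S = "chain_ratio_sum (\<lambda>n. gap 1 (3 + 2 * n)) (\<lambda>n. gap 3 (3 + 2 * n))"
  let ?R = "ratio_sum (\<lambda>i. (sq_weight h c (2 * i + 2) / (1 + h)) * (sq_weight h c (2 * i + 3) / (1 + h)))"
  let ?C = "\<lambda>\<tau> N. h * ((1 + c)\<^sup>2 / c) / (1 + h * (1 + c)) \<le> cubic_slope h c * \<tau> + 1 / ?R \<tau> N"
  define p where "p = 1 + c + c\<^sup>2 + h * (1 + c)\<^sup>2"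
  define \<sigma> where "\<sigma> = (p / c)\<^sup>2 * (1 + h)\<^sup>2"
  have p: "0 < p" using h c by (simp add: p_def add_pos_pos)
  have \<sigma>: "0 < \<sigma>" using h c p by (simp add: \<sigma>_def)
  have p_eq: "(1 + h) * ((1 + c)\<^sup>2 / c) - 1 = p / c"
    using c by (simp add: p_def field_simps power2_eq_square)
  have S: "?S t N = ?R (t * \<sigma>) N" for t N
  proof (rule ratio_sum_cong)
    fix i
    have "gap 3 (3 + 2 * Suc i) / gap 1 (3 + 2 * Suc i) = (p / c)\<^sup>2 * (sq_weight h c (2 * i + 2) * sq_weight h c (2 * i + 3))"
      using gap_ratio_2[OF h c, of "2 * i"] unfolding p_eq by (simp add: add.commute)
    then show "t * (gap 3 (3 + 2 * Suc i) / gap 1 (3 + 2 * Suc i))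
        = t * \<sigma> * (sq_weight h c (2 * i + 2) / (1 + h) * (sq_weight h c (2 * i + 3) / (1 + h)))"
      using h by (simp add: \<sigma>_def power2_eq_square)
  qed
  have slope: "cubic_slope h c * \<sigma> = (1 + h) * (1 + c) * (p + 1) / c"
  proof -
    have "cubic_slope h c = (1 + c) * c * (p + 1) / ((1 + h) * p\<^sup>2)"
      unfolding cubic_slope_def Let_def p_def ..
    then show ?thesis using h c p by (simp add: \<sigma>_def power2_eq_square)
  qed
  have eq: "(h * (1 + c))\<^sup>2 / sq_weight h c 3 \<le> t * gap 3 3 + c * h / ?S t N \<longleftrightarrow> ?C (t * \<sigma>) N" for t N
  proof -
    have "(h * (1 + c))\<^sup>2 / sq_weight h c 3 = (c * h) * (h * ((1 + c)\<^sup>2 / c) / (1 + h * (1 + c)))"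
      unfolding sq_weight_3[OF h] using h c by (simp add: power2_eq_square)
    moreover have "t * gap 3 3 + c * h / ?S t N = (c * h) * (cubic_slope h c * (t * \<sigma>) + 1 / ?R (t * \<sigma>) N)"
    proof -
      have "cubic_slope h c * (t * \<sigma>) = t * ((1 + h) * (1 + c) * (p + 1) / c)"
        unfolding slope[symmetric] by simp
      moreover have "t * gap 3 3 = (c * h) * (t * ((1 + h) * (1 + c) * (p + 1) / c))"
        unfolding gap_3_3 p_def using c by simp
      ultimately show ?thesis unfolding S by (simp add: distrib_left)
    qed
    ultimately show ?thesis using h c by (simp only: mult_le_cancel_left_pos mult_pos_pos)
  qed
  have "semi_cubically_hyponormal (weighted_shift (compl_weight h c)) \<longleftrightarrow>
    (\<forall>t>0. \<forall>N z. (\<forall>n. 0 \<le> z n) \<longrightarrow> 0 \<le> section_form (compl_weight h c) 2 t N z)"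
    by (rule semi_cubically_hyponormal_iff_sections[OF compl_weight_bounded[OF h c]
          diag_gap_compl_weight_nonneg[OF h c] diag_gap_compl_weight_nonneg[OF h c] cross_gap_compl_weight_nonneg[OF h c]])
  also have "\<dots> \<longleftrightarrow> (\<forall>t>0. \<forall>N. ?C (t * \<sigma>) N)"
    using cubic_sections_iff eq by simp
  also have "\<dots> \<longleftrightarrow> cubic_criterion h c"
    unfolding cubic_criterion_def
  proof (intro iffI allI impI)
    fix \<tau> :: real and N assume "\<forall>t>0. \<forall>N. ?C (t * \<sigma>) N" "0 < \<tau>"
    moreover have "0 < \<tau> / \<sigma>" "\<tau> / \<sigma> * \<sigma> = \<tau>" using \<open>0 < \<tau>\<close> \<sigma> by auto
    ultimately have "?C (\<tau> / \<sigma> * \<sigma>) N" by blast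
    then show "?C \<tau> N" unfolding \<open>\<tau> / \<sigma> * \<sigma> = \<tau>\<close> .
  next
    fix t :: real and N assume "\<forall>\<tau>>0. \<forall>N. ?C \<tau> N" "0 < t"
    moreover have "0 < t * \<sigma>" using \<open>0 < t\<close> \<sigma> by simp
    ultimately show "?C (t * \<sigma>) N" by blast
  qed
  finally show ?thesis .
qed

end

section \<open>Monotonicity along rays and starlikeness\<close>

lemma sq_weight_step_mono:
  assumes "0 \<le> c" "c \<le> c'" "1 \<le> b" "b \<le> (b'::real)"
  shows "1 + c * (1 - 1 / b) \<le> 1 + c' * (1 - 1 / b')"
proof -
  have "1 / b' \<le> 1 / b" "1 / b \<le> 1" using assms by (simp_all add: frac_le)
  then show ?thesis using assms by (intro add_left_mono mult_mono) auto
qed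

lemma sq_weight_mono_params:
  assumes "0 \<le> h" "h \<le> h'" "0 \<le> c" "c \<le> c'"
  shows "sq_weight h c n \<le> sq_weight h' c' n"
proof -
  have "sq_weight h c (Suc n) \<le> sq_weight h' c' (Suc n)" for n
  proof (induction n)
    case (Suc n)
    have b: "1 \<le> sq_weight h c (Suc n)" using assms by (intro sq_weight_ge_1)
    have "1 + c * (1 - 1 / sq_weight h c (Suc n)) \<le> 1 + c' * (1 - 1 / sq_weight h' c' (Suc n))"
      using assms b Suc by (intro sq_weight_step_mono)
    moreover have "0 \<le> 1 + c * (1 - 1 / sq_weight h c (Suc n))" using assms b by simp
    ultimately show ?case unfolding sq_weight.simps(3) using assms by (intro mult_mono) auto
  qed simp
  then show ?thesis by (cases n) auto
qed

text \<open>Dividing by \<open>1 + h\<close> removes only the explicit dependence of the recursion on \<open>h\<close>; the previous term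
  still increases with \<open>h\<close>.\<close>

lemma scaled_sq_weight_mono:
  assumes "0 < h" "h \<le> h'" "0 < c"
  shows "sq_weight h c (Suc (Suc n)) / (1 + h) \<le> sq_weight h' c (Suc (Suc n)) / (1 + h')"
  unfolding sq_weight.simps(3) using assms sq_weight_ge_1[of h c "Suc n"] sq_weight_mono_params[of h h' c c "Suc n"]
    sq_weight_step_mono[of c c "sq_weight h c (Suc n)" "sq_weight h' c (Suc n)"] by simp

text \<open>As \<open>h\<close> decreases, the squared weights decrease, so the reciprocal sum increases, and the explicit
  term increases too.\<close>

lemma quadratic_criterion_antimono:
  assumes "0 < h" "h \<le> h'" "0 < c" "quadratic_criterion h' c"
  shows "quadratic_criterion h c"
  unfolding quadratic_criterion_def
proof (intro allI impI)
  fix \<tau> :: real and N assume \<tau>: "0 < \<tau>"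
  let ?R = "\<lambda>h. ratio_sum (\<lambda>i. (1 + c)\<^sup>2 / c * sq_weight h c (Suc i)) \<tau> N"
  have "1 \<le> ?R h"
    using assms \<tau> sq_weight_pos[of h c] by (intro ratio_sum_ge_1) (simp_all add: less_imp_le)
  moreover have "?R h \<le> ?R h'"
    using assms \<tau> sq_weight_pos[of h c] sq_weight_mono_params[of h h' c c]
    by (intro ratio_sum_mono mult_left_mono) (simp_all add: less_imp_le)
  ultimately have "1 / ?R h' \<le> 1 / ?R h" by (simp add: frac_le)
  moreover have "\<tau> / (1 + h') * (1 + 1 / (h' + \<tau>)) \<le> \<tau> / (1 + h) * (1 + 1 / (h + \<tau>))"
    using assms \<tau> by (intro mult_mono add_left_mono divide_left_mono) (auto intro: add_pos_pos)
  moreover have "1 \<le> (1 + c) * \<tau> + \<tau> / (1 + h') * (1 + 1 / (h' + \<tau>)) + 1 / ?R h'"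
    using assms(4) \<tau> unfolding quadratic_criterion_def by blast
  ultimately show "1 \<le> (1 + c) * \<tau> + \<tau> / (1 + h) * (1 + 1 / (h + \<tau>)) + 1 / ?R h"
    by linarith
qed

text \<open>\<^const>\<open>cubic_slope\<close> with the increasing and the decreasing dependence on \<open>c\<close> separated into \<open>a\<close>
  and \<open>b\<close>, so that \<open>c\<close> can be replaced by the endpoints of an interval.\<close>

definition slope_majorant :: "real \<Rightarrow> real \<Rightarrow> real \<Rightarrow> real" where
  "slope_majorant h a b = (let p = 1 + b + b\<^sup>2 + h * (1 + b)\<^sup>2 in (1 + a) * a / (1 + h) * (1 / p + 1 / p\<^sup>2))"

lemma cubic_slope_eq:
  assumes "0 < h" "0 < c" shows "cubic_slope h c = slope_majorant h c c"
proof -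
  define p where "p = 1 + c + c\<^sup>2 + h * (1 + c)\<^sup>2"
  have "0 < p" using assms by (simp add: p_def add_pos_pos)
  then have "(p + 1) / p\<^sup>2 = 1 / p + 1 / p\<^sup>2" by (simp add: add_divide_distrib power2_eq_square)
  moreover have "cubic_slope h c = (1 + c) * c / (1 + h) * ((p + 1) / p\<^sup>2)"
    unfolding cubic_slope_def Let_def p_def by simp
  ultimately show ?thesis by (simp add: slope_majorant_def Let_def p_def)
qed

lemma slope_majorant_mono:
  assumes "0 < h" "h \<le> h'" "0 < a" "a \<le> a'" "0 < b" "b \<le> b'"
  shows "slope_majorant h' a b' \<le> slope_majorant h a' b"
proof -
  let ?p = "\<lambda>h b. 1 + b + b\<^sup>2 + h * (1 + b)\<^sup>2"
  have p: "0 < ?p h b" using assms by (simp add: add_pos_pos)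
  have le: "?p h b \<le> ?p h' b'" using assms by (intro add_mono mult_mono power_mono) auto
  then have sq: "(?p h b)\<^sup>2 \<le> (?p h' b')\<^sup>2" using p by (intro power_mono) auto
  have p': "0 < ?p h' b'" using p le by linarith
  have "1 / ?p h' b' + 1 / (?p h' b')\<^sup>2 \<le> 1 / ?p h b + 1 / (?p h b)\<^sup>2"
    by (intro add_mono frac_le le sq p zero_less_power) auto
  moreover have "(1 + a) * a / (1 + h') \<le> (1 + a') * a' / (1 + h)"
    using assms by (intro frac_le mult_mono) auto
  moreover have "0 \<le> 1 / ?p h' b' + 1 / (?p h' b')\<^sup>2" using p' by simp
  moreover have "0 \<le> (1 + a') * a' / (1 + h)" using assms by simp
  ultimately show ?thesis unfolding slope_majorant_def Let_def by (intro mult_mono)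
qed

lemma cubic_slope_antimono:
  assumes "0 < h" "h \<le> h'" "0 < c" shows "cubic_slope h' c \<le> cubic_slope h c"
  using assms slope_majorant_mono[of h h' c c c c] by (simp add: cubic_slope_eq)

lemma cubic_offset_mono:
  fixes h h' c :: real
  assumes "0 < h" "h \<le> h'" "0 < c"
  shows "h * ((1 + c)\<^sup>2 / c) / (1 + h * (1 + c)) \<le> h' * ((1 + c)\<^sup>2 / c) / (1 + h' * (1 + c))"
proof -
  have "0 < 1 + h * (1 + c)" "0 < 1 + h' * (1 + c)" using assms by (simp_all add: add_pos_pos)
  then have "h / (1 + h * (1 + c)) \<le> h' / (1 + h' * (1 + c))"
    using assms by (simp add: field_simps)
  then have "h / (1 + h * (1 + c)) * ((1 + c)\<^sup>2 / c) \<le> h' / (1 + h' * (1 + c)) * ((1 + c)\<^sup>2 / c)"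
    using assms by (intro mult_right_mono) auto
  then show ?thesis by (simp only: times_divide_eq_left mult.commute)
qed

lemma cubic_criterion_antimono:
  assumes "0 < h" "h \<le> h'" "0 < c" "cubic_criterion h' c"
  shows "cubic_criterion h c"
  unfolding cubic_criterion_def
proof (intro allI impI)
  fix \<tau> :: real and N assume \<tau>: "0 < \<tau>"
  let ?b = "\<lambda>h. h * ((1 + c)\<^sup>2 / c) / (1 + h * (1 + c))"
  let ?\<rho> = "\<lambda>h i. (sq_weight h c (2 * i + 2) / (1 + h)) * (sq_weight h c (2 * i + 3) / (1 + h))"
  have nonneg: "0 \<le> sq_weight h c n / (1 + h)" for n using assms sq_weight_pos[of h c n] by simp
  have nonneg': "0 \<le> sq_weight h' c n / (1 + h')" for n using assms sq_weight_pos[of h' c n] by simp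
  have le: "?\<rho> h i \<le> ?\<rho> h' i" for i
    using scaled_sq_weight_mono[OF assms(1-3), of "2 * i"] scaled_sq_weight_mono[OF assms(1-3), of "2 * i + 1"]
    by (intro mult_mono nonneg nonneg') (simp_all add: numeral_2_eq_2 numeral_3_eq_3)
  have "1 \<le> ratio_sum (?\<rho> h) \<tau> N" using nonneg \<tau> by (intro ratio_sum_ge_1 mult_nonneg_nonneg) auto
  moreover have "ratio_sum (?\<rho> h) \<tau> N \<le> ratio_sum (?\<rho> h') \<tau> N"
    using \<tau> le nonneg by (intro ratio_sum_mono mult_nonneg_nonneg) auto
  ultimately have "1 / ratio_sum (?\<rho> h') \<tau> N \<le> 1 / ratio_sum (?\<rho> h) \<tau> N" by (simp add: frac_le)
  moreover have "cubic_slope h' c * \<tau> \<le> cubic_slope h c * \<tau>"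
    using cubic_slope_antimono[OF assms(1-3)] \<tau> by simp
  moreover have "?b h \<le> ?b h'" using cubic_offset_mono[OF assms(1-3)] .
  moreover have "?b h' \<le> cubic_slope h' c * \<tau> + 1 / ratio_sum (?\<rho> h') \<tau> N"
    using assms(4) \<tau> unfolding cubic_criterion_def by blast
  ultimately show "?b h \<le> cubic_slope h c * \<tau> + 1 / ratio_sum (?\<rho> h) \<tau> N" by linarith
qed

lemma weighted_shift_region:
  assumes "0 < h" "0 < k"
  shows "weighted_shift (weights (1 + h) (1 + h + k)) = weighted_shift (compl_weight h (k / h))"
proof -
  have "weights (1 + h) (1 + h + k) = compl_weight h (k / h)"
    using weights_eq_sqrt_sq_weight[OF assms] by (auto simp: compl_weight_def)
  then show ?thesis by simp
qed

lemma region_q_iff: "(h, k) \<in> region_q \<longleftrightarrow> 0 < h \<and> 0 < k \<and> quadratic_criterion h (k / h)"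
  by (auto simp: region_q_def weighted_shift_region quadratically_hyponormal_compl_weight_iff)

lemma region_sc_iff: "(h, k) \<in> region_sc \<longleftrightarrow> 0 < h \<and> 0 < k \<and> cubic_criterion h (k / h)"
  by (auto simp: region_sc_def weighted_shift_region semi_cubically_hyponormal_compl_weight_iff)

text \<open>Scaling \<open>(h, k)\<close> by \<open>s\<close> keeps the slope \<open>k / h\<close> and decreases \<open>h\<close>.\<close>

lemma starlike_regions: "starlike_region (region_q \<inter> region_sc)"
  unfolding starlike_region_def
proof (intro conjI allI impI)
  show "region_q \<inter> region_sc \<subseteq> {(h, k). 0 < h \<and> 0 < k}" by (auto simp: region_q_def)
  fix h k s :: real
  assume "(h, k) \<in> region_q \<inter> region_sc \<and> 0 < s \<and> s \<le> 1"
  then have hk: "0 < h" "0 < k" "quadratic_criterion h (k / h)" "cubic_criterion h (k / h)"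
    and s: "0 < s" "s \<le> 1"
    by (auto simp: region_q_iff region_sc_iff)
  have "0 < s * h" "s * h \<le> h" "0 < k / h" using hk s by (auto simp: mult_left_le_one_le)
  then show "(s * h, s * k) \<in> region_q \<inter> region_sc"
    using hk s quadratic_criterion_antimono[of "s * h" h "k / h"] cubic_criterion_antimono[of "s * h" h "k / h"]
    by (simp add: region_q_iff region_sc_iff)
qed

section \<open>Tests at a single parameter value\<close>

lemma sq_weight_le_fixed_point:
  assumes "0 < h" "0 < c" "1 \<le> L" "(1 + h) * (1 + c * (1 - 1 / L)) \<le> L"
  shows "sq_weight h c n \<le> L"
proof -
  have "sq_weight h c (Suc n) \<le> L" for n
  proof (induction n)
    case (Suc n)
    have "1 + c * (1 - 1 / sq_weight h c (Suc n)) \<le> 1 + c * (1 - 1 / L)"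
      using assms Suc sq_weight_ge_1[of h c "Suc n"] by (intro sq_weight_step_mono) auto
    then have "sq_weight h c (Suc (Suc n)) \<le> (1 + h) * (1 + c * (1 - 1 / L))"
      unfolding sq_weight.simps(3) using assms by (intro mult_left_mono) auto
    then show ?case using assms by linarith
  qed (use assms in simp)
  then show ?thesis using assms by (cases n) auto
qed

lemma saturation_mono:
  fixes h s t :: real
  assumes "0 < h" "0 < s" "s \<le> t" shows "s / (h + s) \<le> t / (h + t)"
  using assms by (simp add: field_simps)

text \<open>Below \<open>1 / \<rho>\<close> the sum is at most a geometric series, whence its reciprocal is at least
  \<open>1 - \<tau> * \<rho>\<close> while the explicit term is at least \<open>\<tau> * \<rho>\<close>; at \<open>1 / \<rho>\<close> and beyond, the explicit term alone is at
  least \<open>1\<close>. With \<open>L\<close> the limit of the squared weights and \<open>\<rho> = (1 + c)\<^sup>2 / c * L\<close> the test is sharp,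
  because the sum diverges at \<open>1 / \<rho>\<close>.\<close>

lemma quadratic_criterion_holds:
  assumes hc: "0 < h" "0 < c" and L: "1 \<le> L" "(1 + h) * (1 + c * (1 - 1 / L)) \<le> L"
    and \<rho>: "(1 + c)\<^sup>2 / c * L \<le> \<rho>" "\<rho> \<le> (1 + c) + 1 / (1 + h) * (1 + 1 / (h + 1 / \<rho>))"
  shows "quadratic_criterion h c"
  unfolding quadratic_criterion_def
proof (intro allI impI)
  fix \<tau> :: real and N assume \<tau>: "0 < \<tau>"
  let ?R = "ratio_sum (\<lambda>i. (1 + c)\<^sup>2 / c * sq_weight h c (Suc i)) \<tau> N"
  have "0 < (1 + c)\<^sup>2 / c * L" using hc L by simp
  then have \<rho>0: "0 < \<rho>" using \<rho> by linarith
  have nn: "0 \<le> (1 + c)\<^sup>2 / c * sq_weight h c (Suc i)" for i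
    using hc sq_weight_pos[OF hc] by (simp add: less_imp_le)
  have R: "0 < 1 / ?R" using ratio_sum_ge_1[of \<tau> "\<lambda>i. (1 + c)\<^sup>2 / c * sq_weight h c (Suc i)" N] nn \<tau> by simp
  show "1 \<le> (1 + c) * \<tau> + \<tau> / (1 + h) * (1 + 1 / (h + \<tau>)) + 1 / ?R"
  proof (cases "\<tau> * \<rho> < 1")
    case True
    have "(1 + c)\<^sup>2 / c * sq_weight h c (Suc i) \<le> \<rho>" for i
    proof -
      have "(1 + c)\<^sup>2 / c * sq_weight h c (Suc i) \<le> (1 + c)\<^sup>2 / c * L"
        using hc sq_weight_le_fixed_point[OF hc L] by (intro mult_left_mono) auto
      then show ?thesis using \<rho>(1) by linarith
    qed
    then have "1 - \<tau> * \<rho> \<le> 1 / ?R"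
      using \<tau> nn True by (intro ratio_sum_geometric_bound) auto
    moreover have "\<tau> * \<rho> \<le> (1 + c) * \<tau> + \<tau> / (1 + h) * (1 + 1 / (h + \<tau>))"
    proof -
      have "1 / (h + 1 / \<rho>) \<le> 1 / (h + \<tau>)"
        using True hc \<tau> \<rho>0 by (intro divide_left_mono add_left_mono mult_pos_pos add_pos_pos) (auto simp: field_simps)
      then have "1 / (1 + h) * (1 + 1 / (h + 1 / \<rho>)) \<le> 1 / (1 + h) * (1 + 1 / (h + \<tau>))"
        using hc by (intro mult_left_mono) auto
      then have "\<tau> * \<rho> \<le> \<tau> * ((1 + c) + 1 / (1 + h) * (1 + 1 / (h + \<tau>)))"
        using \<rho>(2) \<tau> by (intro mult_left_mono) auto
      then show ?thesis by (simp add: algebra_simps)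
    qed
    ultimately show ?thesis by linarith
  next
    case False
    have expand: "s * ((1 + c) + 1 / (1 + h) * (1 + 1 / (h + s)))
        = (1 + c) * s + 1 / (1 + h) * (s + s / (h + s))" for s
      by (simp add: algebra_simps)
    let ?s = "1 / \<rho>"
    have s: "0 < ?s" "?s \<le> \<tau>" using False \<rho>0 by (simp_all add: field_simps)
    have "1 = ?s * \<rho>" using \<rho>0 by simp
    also have "\<dots> \<le> ?s * ((1 + c) + 1 / (1 + h) * (1 + 1 / (h + ?s)))"
      using \<rho>(2) s(1) by (intro mult_left_mono) auto
    also have "\<dots> = (1 + c) * ?s + 1 / (1 + h) * (?s + ?s / (h + ?s))"
      by (rule expand)
    also have "\<dots> \<le> (1 + c) * \<tau> + 1 / (1 + h) * (\<tau> + \<tau> / (h + \<tau>))"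
    proof -
      have "?s / (h + ?s) \<le> \<tau> / (h + \<tau>)" using hc s by (intro saturation_mono) auto
      then show ?thesis using s hc by (intro add_mono mult_left_mono) auto
    qed
    also have "\<dots> = (1 + c) * \<tau> + \<tau> / (1 + h) * (1 + 1 / (h + \<tau>))"
      by (simp add: algebra_simps)
    finally show ?thesis using R by linarith
  qed
qed

text \<open>From \<open>n0\<close> on the summands do not decrease, so the reciprocal sums tend to \<open>0\<close> and only the explicit
  term is left.\<close>

lemma quadratic_criterion_fails:
  assumes hc: "0 < h" "0 < c" and \<tau>: "0 < \<tau>" and l: "l \<le> sq_weight h c (Suc n0)"
    and ge: "1 \<le> \<tau> * ((1 + c)\<^sup>2 / c * l)"
    and less: "(1 + c) * \<tau> + \<tau> / (1 + h) * (1 + 1 / (h + \<tau>)) < 1"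
  shows "\<not> quadratic_criterion h c"
proof
  assume Q: "quadratic_criterion h c"
  let ?\<rho> = "\<lambda>i. (1 + c)\<^sup>2 / c * sq_weight h c (Suc i)"
  define \<delta> where "\<delta> = 1 - ((1 + c) * \<tau> + \<tau> / (1 + h) * (1 + 1 / (h + \<tau>)))"
  have \<delta>: "0 < \<delta>" using less by (simp add: \<delta>_def)
  have pos: "0 < ?\<rho> i" for i using hc sq_weight_pos[OF hc] by simp
  have large: "1 \<le> \<tau> * ?\<rho> i" if "n0 \<le> i" for i
  proof -
    have "l \<le> sq_weight h c (Suc i)" using l sq_weight_mono[OF hc, of "Suc n0" "Suc i"] that by simp
    then have "\<tau> * ((1 + c)\<^sup>2 / c * l) \<le> \<tau> * ?\<rho> i" using hc \<tau> by (intro mult_left_mono) auto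
    then show ?thesis using ge by linarith
  qed
  obtain N where N: "1 / \<delta> < ratio_sum ?\<rho> \<tau> N" using ratio_sum_unbounded[of \<tau> ?\<rho> n0 "1 / \<delta>"] \<tau> pos large by blast
  have "0 < 1 / \<delta>" using \<delta> by simp
  then have "0 < ratio_sum ?\<rho> \<tau> N" using N by linarith
  then have "1 / ratio_sum ?\<rho> \<tau> N < \<delta>" using N \<delta> by (simp add: field_simps)
  moreover have "1 \<le> (1 + c) * \<tau> + \<tau> / (1 + h) * (1 + 1 / (h + \<tau>)) + 1 / ratio_sum ?\<rho> \<tau> N"
    using Q \<tau> unfolding quadratic_criterion_def by blast
  ultimately show False unfolding \<delta>_def by linarith
qed

text \<open>As in the quadratic case; the lower bound \<open>cubic_slope h c * \<tau> + 1 - \<tau> * (L / (1 + h))\<^sup>2\<close> is affine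
  in \<open>\<tau>\<close>, so it suffices to look at the ends of the interval on which it is used.\<close>

lemma cubic_criterion_holds:
  assumes hc: "0 < h" "0 < c" and L: "1 \<le> L" "(1 + h) * (1 + c * (1 - 1 / L)) \<le> L"
    and b: "h * ((1 + c)\<^sup>2 / c) / (1 + h * (1 + c)) \<le> b" "b \<le> 1" "b * (L / (1 + h))\<^sup>2 \<le> cubic_slope h c"
  shows "cubic_criterion h c"
  unfolding cubic_criterion_def
proof (intro allI impI)
  fix \<tau> :: real and N assume \<tau>: "0 < \<tau>"
  let ?\<rho> = "\<lambda>i. (sq_weight h c (2 * i + 2) / (1 + h)) * (sq_weight h c (2 * i + 3) / (1 + h))"
  let ?M = "(L / (1 + h))\<^sup>2"
  have nn: "0 \<le> sq_weight h c n / (1 + h)" for n using hc sq_weight_pos[OF hc, of n] by simp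
  have nn': "0 \<le> ?\<rho> i" for i by (intro mult_nonneg_nonneg nn)
  have R: "0 < 1 / ratio_sum ?\<rho> \<tau> N" using ratio_sum_ge_1[of \<tau> ?\<rho> N] nn' \<tau> by simp
  have bM: "b * (\<tau> * ?M) \<le> cubic_slope h c * \<tau>"
    using mult_left_mono[OF b(3), of \<tau>] \<tau> by (simp add: mult_ac)
  have "b \<le> cubic_slope h c * \<tau> + 1 / ratio_sum ?\<rho> \<tau> N"
  proof (cases "\<tau> * ?M < 1")
    case True
    have le: "sq_weight h c n / (1 + h) \<le> L / (1 + h)" for n
      using sq_weight_le_fixed_point[OF hc L] hc by (intro divide_right_mono) auto
    have "?\<rho> i \<le> ?M" for i
      unfolding power2_eq_square using hc L by (intro mult_mono le nn) auto
    then have "1 - \<tau> * ?M \<le> 1 / ratio_sum ?\<rho> \<tau> N"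
      using \<tau> True nn' by (intro ratio_sum_geometric_bound) auto
    moreover have "0 \<le> (1 - b) * (1 - \<tau> * ?M)" using True b by simp
    ultimately show ?thesis using bM by (simp add: algebra_simps)
  next
    case False
    have "0 < h * ((1 + c)\<^sup>2 / c) / (1 + h * (1 + c))" using hc by (simp add: add_pos_pos)
    then have "0 \<le> b" using b(1) by linarith
    then have "b * 1 \<le> b * (\<tau> * ?M)" using False by (intro mult_left_mono) auto
    then show ?thesis using bM R by linarith
  qed
  then show "h * ((1 + c)\<^sup>2 / c) / (1 + h * (1 + c)) \<le> cubic_slope h c * \<tau> + 1 / ratio_sum ?\<rho> \<tau> N"
    using b(1) by linarith
qed

lemma cubic_criterion_fails:
  assumes hc: "0 < h" "0 < c" and \<tau>: "0 < \<tau>" and l: "0 \<le> l" "l \<le> sq_weight h c (2 * n0 + 2)"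
    and ge: "1 \<le> \<tau> * (l / (1 + h))\<^sup>2"
    and less: "cubic_slope h c * \<tau> < h * ((1 + c)\<^sup>2 / c) / (1 + h * (1 + c))"
  shows "\<not> cubic_criterion h c"
proof
  assume C: "cubic_criterion h c"
  let ?\<rho> = "\<lambda>i. (sq_weight h c (2 * i + 2) / (1 + h)) * (sq_weight h c (2 * i + 3) / (1 + h))"
  define \<delta> where "\<delta> = h * ((1 + c)\<^sup>2 / c) / (1 + h * (1 + c)) - cubic_slope h c * \<tau>"
  have \<delta>: "0 < \<delta>" using less by (simp add: \<delta>_def)
  have pos: "0 < ?\<rho> i" for i using hc sq_weight_pos[OF hc] by simp
  have large: "1 \<le> \<tau> * ?\<rho> i" if "n0 \<le> i" for i
  proof -
    have "l \<le> sq_weight h c (2 * i + 2)" "l \<le> sq_weight h c (2 * i + 3)"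
      using l sq_weight_mono[OF hc, of "2 * n0 + 2" "2 * i + 2"] sq_weight_mono[OF hc, of "2 * n0 + 2" "2 * i + 3"] that
      by linarith+
    then have "(l / (1 + h))\<^sup>2 \<le> ?\<rho> i"
      unfolding power2_eq_square using hc l by (intro mult_mono divide_right_mono) auto
    then have "\<tau> * (l / (1 + h))\<^sup>2 \<le> \<tau> * ?\<rho> i" using \<tau> by (intro mult_left_mono) auto
    then show ?thesis using ge by linarith
  qed
  obtain N where N: "1 / \<delta> < ratio_sum ?\<rho> \<tau> N" using ratio_sum_unbounded[of \<tau> ?\<rho> n0 "1 / \<delta>"] \<tau> pos large by blast
  have "0 < 1 / \<delta>" using \<delta> by simp
  then have "0 < ratio_sum ?\<rho> \<tau> N" using N by linarith
  then have "1 / ratio_sum ?\<rho> \<tau> N < \<delta>" using N \<delta> by (simp add: field_simps)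
  moreover have "h * ((1 + c)\<^sup>2 / c) / (1 + h * (1 + c)) \<le> cubic_slope h c * \<tau> + 1 / ratio_sum ?\<rho> \<tau> N"
    using C \<tau> unfolding cubic_criterion_def by blast
  ultimately show False unfolding \<delta>_def by linarith
qed

section \<open>Three open sectors\<close>

text \<open>The thresholds for \<open>h\<close> are about \<open>0.05927\<close> (quadratic) and \<open>0.05954\<close> (cubic) at \<open>c = 1 / 4\<close>,
  and about \<open>0.02389\<close> (quadratic) and \<open>0.02097\<close> (cubic) at \<open>c = 3\<close>. The values of \<open>h\<close> used below lie
  between the two, except for \<open>1 / 25\<close> and \<open>1 / 20\<close>, which are below both thresholds near \<open>c = 1 / 4\<close>
  and serve for the intersection. Each \<open>L\<close> slightly
  exceeds the limit of the squared weights, each \<open>l\<close> is slightly less than a late term, and each \<open>\<tau>\<close>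
  is slightly larger than the reciprocal of the resulting ratio.\<close>

lemma kappa_expand: "0 < c \<Longrightarrow> (1 + c)\<^sup>2 / c = c + 2 + 1 / (c::real)"
  by (simp add: field_simps power2_eq_square)

lemma sq_weight_values:
  "5393 / 5000 \<le> sq_weight (297 / 5000) (1 / 4) 6" "77 / 25 \<le> sq_weight (11 / 500) 3 10"
  by (simp_all add: eval_nat_numeral sq_weight.simps(3))

lemma near_quarter_q_fails:
  fixes c :: real
  assumes "1 / 4 < c" "c < 2501 / 10000"
  shows "\<not> quadratic_criterion (297 / 5000) c"
proof (rule quadratic_criterion_fails[where l = "5393 / 5000" and \<tau> = "371 / 2500" and ?n0.0 = 5])
  show "5393 / 5000 \<le> sq_weight (297 / 5000) c (Suc 5)"
    using sq_weight_values(1) sq_weight_mono_params[of "297 / 5000" "297 / 5000" "1 / 4" c 6] assms by simp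
  have "10000 / 2501 \<le> 1 / c" using assms by (simp add: field_simps)
  then show "1 \<le> 371 / 2500 * ((1 + c)\<^sup>2 / c * (5393 / 5000))"
    using assms by (simp add: kappa_expand)
  have "(1 + c) * (371 / 2500) < 18552 / 100000" using assms by simp
  moreover have "371 / 2500 / (1 + 297 / 5000) * (1 + 1 / (297 / 5000 + 371 / 2500)) \<le> (8143 / 10000 :: real)"
    by simp
  ultimately have "(1 + c) * (371 / 2500) + 371 / 2500 / (1 + 297 / 5000) * (1 + 1 / (297 / 5000 + 371 / 2500))
      < 18552 / 100000 + 8143 / 10000" by (rule add_less_le_mono)
  also have "\<dots> < 1" by simp
  finally show "(1 + c) * (371 / 2500) + 371 / 2500 / (1 + 297 / 5000) * (1 + 1 / (297 / 5000 + 371 / 2500)) < 1" .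
qed (use assms in auto)

lemma near_quarter_sc_holds:
  fixes c :: real
  assumes "1 / 4 < c" "c < 2501 / 10000"
  shows "cubic_criterion (1189 / 20000) c"
proof (rule cubic_criterion_holds[where L = "1079 / 1000" and b = "346 / 1000"])
  let ?h = "1189 / 20000 :: real"
  have "346 / 1000 * (1079 / 1000 / (1 + ?h))\<^sup>2 \<le> slope_majorant ?h (1 / 4) (2501 / 10000)"
    by (simp add: slope_majorant_def power2_eq_square)
  also have "\<dots> \<le> cubic_slope ?h c"
    using assms slope_majorant_mono[of ?h ?h "1 / 4" c c "2501 / 10000"] by (simp add: cubic_slope_eq)
  finally show "346 / 1000 * (1079 / 1000 / (1 + ?h))\<^sup>2 \<le> cubic_slope ?h c" .
  have "1 / c \<le> 4" using assms by (simp add: field_simps)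
  then have "(1 + c)\<^sup>2 / c \<le> 6251 / 1000" using assms by (simp add: kappa_expand)
  then have "?h * ((1 + c)\<^sup>2 / c) \<le> ?h * (6251 / 1000)" by (rule mult_left_mono) simp
  then have "?h * ((1 + c)\<^sup>2 / c) / (1 + ?h * (1 + c)) \<le> ?h * (6251 / 1000) / (1 + ?h * (5 / 4))"
    by (intro frac_le) (use assms in auto)
  also have "\<dots> \<le> 346 / 1000" by simp
  finally show "?h * ((1 + c)\<^sup>2 / c) / (1 + ?h * (1 + c)) \<le> 346 / 1000" .
qed (use assms in auto)

lemma near_quarter_q_holds:
  fixes c :: real
  assumes "1 / 4 < c" "c < 2501 / 10000"
  shows "quadratic_criterion (1 / 20) c"
proof (rule quadratic_criterion_holds[where L = "1067 / 1000" and \<rho> = "67 / 10"])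
  have "1 / c \<le> 4" using assms by (simp add: field_simps)
  then show "(1 + c)\<^sup>2 / c * (1067 / 1000) \<le> 67 / 10" using assms by (simp add: kappa_expand)
qed (use assms in auto)

lemma near_three_sc_fails:
  fixes c :: real
  assumes "3 < c" "c < 301 / 100"
  shows "\<not> cubic_criterion (11 / 500) c"
proof (rule cubic_criterion_fails[where l = "77 / 25" and \<tau> = "111 / 1000" and ?n0.0 = 4])
  let ?h = "11 / 500 :: real"
  show "77 / 25 \<le> sq_weight ?h c (2 * 4 + 2)"
    using sq_weight_values(2) sq_weight_mono_params[of ?h ?h 3 c 10] assms by simp
  have "cubic_slope ?h c \<le> slope_majorant ?h (301 / 100) 3"
    using assms slope_majorant_mono[of ?h ?h c "301 / 100" 3 c] by (simp add: cubic_slope_eq)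
  then have "cubic_slope ?h c * (111 / 1000) \<le> slope_majorant ?h (301 / 100) 3 * (111 / 1000)" by simp
  also have "\<dots> < ?h * (16 / 3) / (1 + ?h * (1 + 301 / 100))"
    by (simp add: slope_majorant_def power2_eq_square)
  also have "\<dots> \<le> ?h * ((1 + c)\<^sup>2 / c) / (1 + ?h * (1 + c))"
  proof (rule frac_le)
    have "0 \<le> (c - 3) * (3 * c - 1)" using assms by simp
    then have "16 / 3 * c \<le> (1 + c)\<^sup>2" by (simp add: power2_eq_square algebra_simps)
    then have "16 / 3 \<le> (1 + c)\<^sup>2 / c" using assms by (simp add: pos_le_divide_eq)
    then show "?h * (16 / 3) \<le> ?h * ((1 + c)\<^sup>2 / c)" by (rule mult_left_mono) simp
    show "0 < 1 + ?h * (1 + c)" using assms by (intro add_pos_nonneg mult_nonneg_nonneg) auto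
  qed (use assms in auto)
  finally show "cubic_slope ?h c * (111 / 1000) < ?h * ((1 + c)\<^sup>2 / c) / (1 + ?h * (1 + c))" .
qed (use assms in \<open>auto simp: power2_eq_square\<close>)

lemma near_three_q_holds:
  fixes c :: real
  assumes "3 < c" "c < 301 / 100"
  shows "quadratic_criterion (9 / 400) c"
proof (rule quadratic_criterion_holds[where L = "3113 / 1000" and \<rho> = "167 / 10"])
  have "1 / c \<le> 1 / 3" using assms by (simp add: field_simps)
  then have "(1 + c)\<^sup>2 / c \<le> 301 / 100 + 2 + 1 / 3" using assms kappa_expand[of c] by linarith
  then have "(1 + c)\<^sup>2 / c * (3113 / 1000) \<le> (301 / 100 + 2 + 1 / 3) * (3113 / 1000)"
    by (rule mult_right_mono) simp
  also have "\<dots> \<le> 167 / 10" by simp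
  finally show "(1 + c)\<^sup>2 / c * (3113 / 1000) \<le> 167 / 10" .
qed (use assms in auto)

text \<open>In the coordinates \<open>h\<close> and \<open>c = k / h\<close> the set is a rectangle; in \<open>(h, k)\<close> it is still described
  by strict linear inequalities.\<close>

lemma open_cone_sector_interior:
  fixes V :: "(real \<times> real) set"
  assumes "0 < h1" "h1 < h2" "0 < c1" "c1 < c2"
    and sub: "\<And>h c. h1 < h \<Longrightarrow> h < h2 \<Longrightarrow> c1 < c \<Longrightarrow> c < c2 \<Longrightarrow> (h, c * h) \<in> V"
  shows "interior V \<noteq> {}"
proof -
  let ?U = "{p. h1 < fst p \<and> fst p < h2 \<and> c1 * fst p < snd p \<and> snd p < c2 * fst p}"
  have "open ?U" by (intro open_Collect_conj open_Collect_less continuous_intros)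
  moreover have "?U \<subseteq> V"
  proof
    fix p assume p: "p \<in> ?U"
    then have "0 < fst p" using assms by auto
    then have "(fst p, snd p / fst p * fst p) \<in> V"
      using p by (intro sub) (auto simp: field_simps)
    then show "p \<in> V" using \<open>0 < fst p\<close> by simp
  qed
  moreover have "((h1 + h2) / 2, (c1 + c2) / 2 * ((h1 + h2) / 2)) \<in> ?U"
    using assms by auto
  ultimately show ?thesis using interior_maximal by blast
qed

theorem corollary3p2:
  shows "(starlike_region (region_q \<inter> region_sc) \<and> interior (region_q \<inter> region_sc) \<noteq> {}) \<and>
    (interior (region_sc - region_q) \<noteq> {} \<and> interior (region_q - region_sc) \<noteq> {})"
proof (intro conjI)
  show "starlike_region (region_q \<inter> region_sc)" by (rule starlike_regions)
  show "interior (region_q \<inter> region_sc) \<noteq> {}"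
  proof (rule open_cone_sector_interior)
    fix h c :: real assume "1 / 25 < h" "h < 1 / 20" "1 / 4 < c" "c < 2501 / 10000"
    then show "(h, c * h) \<in> region_q \<inter> region_sc"
      using quadratic_criterion_antimono[of h "1 / 20" c, OF _ _ _ near_quarter_q_holds]
        cubic_criterion_antimono[of h "1189 / 20000" c, OF _ _ _ near_quarter_sc_holds]
      by (auto simp: region_q_iff region_sc_iff)
  qed auto
  show "interior (region_sc - region_q) \<noteq> {}"
  proof (rule open_cone_sector_interior)
    fix h c :: real assume "297 / 5000 < h" "h < 1189 / 20000" "1 / 4 < c" "c < 2501 / 10000"
    then show "(h, c * h) \<in> region_sc - region_q"
      using quadratic_criterion_antimono[of "297 / 5000" h c] near_quarter_q_fails
        cubic_criterion_antimono[of h "1189 / 20000" c, OF _ _ _ near_quarter_sc_holds]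
      by (auto simp: region_q_iff region_sc_iff)
  qed auto
  show "interior (region_q - region_sc) \<noteq> {}"
  proof (rule open_cone_sector_interior)
    fix h c :: real assume "11 / 500 < h" "h < 9 / 400" "3 < c" "c < 301 / 100"
    then show "(h, c * h) \<in> region_q - region_sc"
      using quadratic_criterion_antimono[of h "9 / 400" c, OF _ _ _ near_three_q_holds]
        cubic_criterion_antimono[of "11 / 500" h c] near_three_sc_fails
      by (auto simp: region_q_iff region_sc_iff)
  qed auto
qed

end
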